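(* Let $N$ be a finite-volume hyperbolic $3$-manifold with compact totally geodesic boundary. If $C$ is a $(1,1,1)$-hexagon in the universal cover $\widetilde{N}$ and $\tilde\lambda_1$ is a lift to $\widetilde N$ of the shortest return path of $N$, then $\tilde\lambda_1$ is an internal edge of $C$ or $\tilde\lambda_1\cap C = \emptyset$.
   Context: Hyperbolic manifolds are complete and connected. If $N$ is a hyperbolic $3$-manifold with totally geodesic boundary, its universal cover $\widetilde N$ is identified with a convex subset of $\mathbb{H}^3$ bounded by a collection of totally geodesic planes, the components of $\partial\widetilde N$. A short cut in $\widetilde N$ is a geodesic arc joining the closest points of two distinct components of $\partial\widetilde N$. A return path in $N$ is the projection of a short cut under the universal covering map. If $N$ has finite volume and compact totally geodesic boundary, there are only finitely many return paths of length less than any given bound; the return paths are enumerated as $\lambda_1,\lambda_2,\ldots$ in order of nondecreasing length, and $\ell_i$ denotes the length of $\lambda_i$. For three distinct components $\Pi_1,\Pi_2,\Pi_3$ of $\partial\widetilde N$, the three short cuts joining them in pairs lie in a common totally geodesic plane, and together with the geodesic arcs in the $\Pi_i$ joining their endpoints they are the edges of a right-angled (two-dimensional, filled) hexagon $C\subset\widetilde N$ in that plane. The edges of $C$ that are short cuts are called internal, and those lying in $\partial\widetilde N$ are called external. $C$ is called an $(i,j,k)$-hexagon if its internal edges are lifts of $\lambda_i$, $\lambda_j$ and $\lambda_k$. *)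

theory Defs
  imports "HOL-Analysis.Analysis"
begin

section \<open>Hyperbolic 3-space\<close>

text \<open>The hyperboloid model: the upper sheet of the unit hyperboloid in Lorentzian space
  \<open>\<real>\<^sup>1\<^sup>,\<^sup>3\<close>, the first factor being the time coordinate.\<close>

definition mink :: "real \<times> (real^3) \<Rightarrow> real \<times> (real^3) \<Rightarrow> real" where
  "mink v w = snd v \<bullet> snd w - fst v * fst w"

typedef hyp3 = "{v :: real \<times> (real^3). mink v v = - 1 \<and> fst v > 0}"
  morphisms coords hyp3
  by (rule exI[of _ "(1, 0)"]) (simp add: mink_def)

lemma mink_coords_self: "mink (coords x) (coords x) = - 1"
  using coords[of x] by simp

lemma fst_coords_pos: "fst (coords x) > 0"
  using coords[of x] by simp

lemma mink_commute: "mink v w = mink w v"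
  by (simp add: mink_def inner_commute mult.commute)

lemma mink_add: "mink (u + v) w = mink u w + mink v w" "mink w (u + v) = mink w u + mink w v"
  by (simp_all add: mink_def inner_add_left inner_add_right algebra_simps)

lemma mink_diff: "mink (u - v) w = mink u w - mink v w" "mink w (u - v) = mink w u - mink w v"
  by (simp_all add: mink_def inner_diff_left inner_diff_right algebra_simps)

lemma mink_scale: "mink (c *\<^sub>R v) w = c * mink v w" "mink w (c *\<^sub>R v) = c * mink w v"
  by (simp_all add: mink_def algebra_simps)

lemma fst_coords: "fst (coords x) = sqrt (1 + snd (coords x) \<bullet> snd (coords x))"
proof -
  have "(fst (coords x))\<^sup>2 = 1 + snd (coords x) \<bullet> snd (coords x)"
    using mink_coords_self[of x] by (simp add: mink_def power2_eq_square)
  then show ?thesis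
    using fst_coords_pos[of x] by (metis less_imp_le real_sqrt_unique)
qed

lemma mink_orthogonal_nonneg:
  assumes "mink w (coords y) = 0"
  shows "mink w w \<ge> 0"
proof -
  define s u t v where "s = fst w" "u = snd w" "t = fst (coords y)" "v = snd (coords y)"
  note d = this
  have t2: "t\<^sup>2 = 1 + v \<bullet> v"
    using mink_coords_self[of y] by (simp add: mink_def d power2_eq_square)
  have eq: "u \<bullet> v = s * t"
    using assms by (simp add: mink_def d)
  have "(u \<bullet> v)\<^sup>2 \<le> (u \<bullet> u) * (v \<bullet> v)"
    by (rule Cauchy_Schwarz_ineq)
  then have "s\<^sup>2 * (1 + v \<bullet> v) \<le> (u \<bullet> u) * (v \<bullet> v)"
    by (simp add: eq power_mult_distrib t2)
  also have "\<dots> \<le> (u \<bullet> u) * (1 + v \<bullet> v)"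
    by (simp add: mult_left_mono)
  finally have "s\<^sup>2 \<le> u \<bullet> u"
    by (smt (verit) inner_ge_zero mult_right_le_imp_le)
  then show ?thesis
    by (simp add: mink_def d power2_eq_square)
qed

lemma mink_orthogonal_CS:
  assumes "mink a (coords y) = 0" "mink b (coords y) = 0"
  shows "(mink a b)\<^sup>2 \<le> mink a a * mink b b"
proof -
  have nn: "mink (c *\<^sub>R a + d *\<^sub>R b) (c *\<^sub>R a + d *\<^sub>R b) \<ge> 0" for c d
    by (rule mink_orthogonal_nonneg[of _ y]) (simp add: mink_add mink_scale assms)
  have ex: "mink (c *\<^sub>R a + d *\<^sub>R b) (c *\<^sub>R a + d *\<^sub>R b)
      = c\<^sup>2 * mink a a + 2 * c * d * mink a b + d\<^sup>2 * mink b b" for c d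
    by (simp add: mink_add mink_scale mink_commute[of b a] power2_eq_square algebra_simps)
  show ?thesis
  proof (cases "mink b b = 0")
    case True
    have "mink a b = 0"
    proof (rule ccontr)
      assume ne: "mink a b \<noteq> 0"
      have "0 \<le> mink a a + 2 * (- (mink a a + 1) / (2 * mink a b)) * mink a b"
        using nn[of 1 "- (mink a a + 1) / (2 * mink a b)"] ex[of 1 "- (mink a a + 1) / (2 * mink a b)"]
        by (simp add: True)
      then show False using ne by (simp add: field_simps)
    qed
    then show ?thesis by (simp add: True)
  next
    case False
    then have pos: "mink b b > 0"
      using mink_orthogonal_nonneg[OF assms(2)] by simp
    have "0 \<le> (mink b b)\<^sup>2 * mink a a + 2 * mink b b * (- mink a b) * mink a b
        + (- mink a b)\<^sup>2 * mink b b"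
      using nn[of "mink b b" "- mink a b"] ex[of "mink b b" "- mink a b"] by simp
    also have "\<dots> = mink b b * (mink a a * mink b b - (mink a b)\<^sup>2)"
      by (simp add: power2_eq_square algebra_simps)
    finally show ?thesis
      using pos by (simp add: zero_le_mult_iff)
  qed
qed

lemma mink_coords_le: "mink (coords x) (coords y) \<le> - 1"
proof -
  define s u t v where "s = fst (coords x)" "u = snd (coords x)" "t = fst (coords y)" "v = snd (coords y)"
  note d = this
  have s: "s = sqrt (1\<^sup>2 + (norm u)\<^sup>2)" and t: "t = sqrt (1\<^sup>2 + (norm v)\<^sup>2)"
    by (simp_all add: d fst_coords power2_norm_eq_inner)
  have "(1 + norm u * norm v)\<^sup>2 \<le> (1 + (norm u)\<^sup>2) * (1 + (norm v)\<^sup>2)"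
    using sum_squares_bound[of "norm u" "norm v"]
    by (simp add: power2_eq_square algebra_simps)
  then have "1 + norm u * norm v \<le> s * t"
    unfolding s t by (simp add: real_le_rsqrt flip: real_sqrt_mult)
  moreover have "u \<bullet> v \<le> norm u * norm v"
    by (rule norm_cauchy_schwarz)
  ultimately show ?thesis
    by (simp add: mink_def d)
qed

instantiation hyp3 :: metric_space
begin

definition dist_hyp3 :: "hyp3 \<Rightarrow> hyp3 \<Rightarrow> real" where
  "dist_hyp3 x y = arcosh (- mink (coords x) (coords y))"

definition uniformity_hyp3 :: "(hyp3 \<times> hyp3) filter" where
  "uniformity_hyp3 = (INF e\<in>{0<..}. principal {(x, y). dist x y < e})"

definition open_hyp3 :: "hyp3 set \<Rightarrow> bool" where
  "open_hyp3 U \<longleftrightarrow> (\<forall>x\<in>U. eventually (\<lambda>(x', y). x' = x \<longrightarrow> y \<in> U) uniformity)"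

instance
proof
  fix x y z :: hyp3
  show "dist x y = 0 \<longleftrightarrow> x = y"
  proof
    assume "dist x y = 0"
    then have m: "mink (coords x) (coords y) = - 1"
      using mink_coords_le[of x y] by (simp add: dist_hyp3_def)
    define w where "w = coords x - coords y"
    have wy: "mink w (coords y) = 0"
      using m by (simp add: w_def mink_diff mink_add mink_scale mink_coords_self)
    have ww: "mink w w = 0"
      using m by (simp add: w_def mink_diff mink_add mink_scale mink_coords_self mink_commute[of "coords y"])
    define s u t v where "s = fst w" "u = snd w" "t = fst (coords y)" "v = snd (coords y)"
    note d = this
    have 1: "u \<bullet> v = s * t" and 2: "u \<bullet> u = s\<^sup>2" and 3: "t\<^sup>2 = 1 + v \<bullet> v"
      using wy ww mink_coords_self[of y] by (simp_all add: mink_def d power2_eq_square)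
    have "(u \<bullet> v)\<^sup>2 \<le> (u \<bullet> u) * (v \<bullet> v)"
      by (rule Cauchy_Schwarz_ineq)
    then have "s\<^sup>2 \<le> 0"
      by (simp add: 1 2 3 power_mult_distrib algebra_simps)
    then have "s = 0" "u = 0" using 2 by simp_all
    then have "w = 0" by (simp add: d prod_eq_iff)
    then show "x = y" by (simp add: w_def coords_inject)
  next
    assume "x = y"
    then show "dist x y = 0" by (simp add: dist_hyp3_def mink_coords_self)
  qed
  have tri: "dist x z \<le> dist x y + dist y z" for x y z :: hyp3
  proof -
    let ?L = "\<lambda>a b. - mink (coords a) (coords b)"
    have ge: "?L a b \<ge> 1" for a b
      using mink_coords_le[of a b] by simp
    define a b where "a = coords x - ?L x y *\<^sub>R coords y" "b = coords z - ?L y z *\<^sub>R coords y"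
    note d = this
    have "mink a (coords y) = 0" "mink b (coords y) = 0"
      by (simp_all add: d mink_diff mink_add mink_scale mink_coords_self mink_commute[of "coords z"])
    note CS = mink_orthogonal_CS[OF this]
    have aa: "mink a a = (?L x y)\<^sup>2 - 1" and bb: "mink b b = (?L y z)\<^sup>2 - 1"
      and ab: "mink a b = ?L x y * ?L y z - ?L x z"
      by (simp_all add: d mink_diff mink_add mink_scale mink_coords_self mink_commute[of "coords z"]
          mink_commute[of "coords y" "coords x"] power2_eq_square algebra_simps)
    have sinh_eq: "sinh (dist a b) = sqrt ((?L a b)\<^sup>2 - 1)" for a b
    proof -
      have "(sinh (dist a b))\<^sup>2 = (?L a b)\<^sup>2 - 1"
        using ge[of a b] by (simp add: dist_hyp3_def sinh_square_eq)
      moreover have "sinh (dist a b) \<ge> 0"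
        using ge[of a b] by (simp add: dist_hyp3_def)
      ultimately show ?thesis by (metis real_sqrt_unique)
    qed
    have "\<bar>mink a b\<bar> \<le> sqrt (mink a a * mink b b)"
      using CS by (metis real_sqrt_abs real_sqrt_le_mono)
    then have "?L x z \<le> ?L x y * ?L y z + sinh (dist x y) * sinh (dist y z)"
      by (simp add: aa bb ab sinh_eq real_sqrt_mult)
    also have "\<dots> = cosh (dist x y + dist y z)"
      using ge[of x y] ge[of y z] by (simp add: cosh_add dist_hyp3_def)
    finally have "cosh (dist x z) \<le> cosh (dist x y + dist y z)"
      using ge[of x z] by (simp add: dist_hyp3_def)
    moreover have "dist x z \<ge> 0" "dist x y + dist y z \<ge> 0"
      using ge by (simp_all add: dist_hyp3_def)
    ultimately show ?thesis
      by (simp add: cosh_real_nonneg_le_iff)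
  qed
  have "dist y z = dist z y"
    by (simp add: dist_hyp3_def mink_commute)
  then show "dist x y \<le> dist x z + dist y z"
    using tri[of x y z] by simp
qed (simp_all add: uniformity_hyp3_def open_hyp3_def)

end

text \<open>The projection \<open>snd \<circ> coords\<close> is a global coordinate system with values in \<open>\<real>\<^sup>3\<close>, in which
  the hyperbolic volume element is \<open>du / sqrt (1 + \<bar>u\<bar>\<^sup>2)\<close>.\<close>

definition of_space :: "real^3 \<Rightarrow> hyp3" where
  "of_space u = hyp3 (sqrt (1 + u \<bullet> u), u)"

lemma coords_of_space: "coords (of_space u) = (sqrt (1 + u \<bullet> u), u)"
  unfolding of_space_def
  by (rule hyp3_inverse) (simp add: mink_def add_pos_nonneg)

lemma continuous_of_space: "continuous_on UNIV of_space"
proof -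
  have "isCont of_space u" for u
  proof -
    let ?f = "\<lambda>v::real^3. sqrt (1 + v \<bullet> v) * sqrt (1 + u \<bullet> u) - v \<bullet> u"
    have eq: "dist (of_space v) (of_space u) = arcosh (?f v)" for v
      by (simp add: dist_hyp3_def coords_of_space mink_def)
    have ge: "?f v \<ge> 1" for v
      using mink_coords_le[of "of_space v" "of_space u"] by (simp add: coords_of_space mink_def)
    have fu: "?f u = 1" by (simp flip: real_sqrt_mult)
    have "((\<lambda>v. ?f v + sqrt ((?f v)\<^sup>2 - 1)) \<longlongrightarrow> 1 + sqrt (1\<^sup>2 - 1)) (at u)"
    proof -
      have "(?f \<longlongrightarrow> ?f u) (at u)"
        by (intro tendsto_intros)
      then have "(?f \<longlongrightarrow> 1) (at u)" by (simp only: fu)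
      then show ?thesis by (intro tendsto_intros)
    qed
    then have "((\<lambda>v. ln (?f v + sqrt ((?f v)\<^sup>2 - 1))) \<longlongrightarrow> ln (1 + sqrt (1\<^sup>2 - 1))) (at u)"
      by (rule tendsto_ln) simp
    then have "((\<lambda>v. dist (of_space v) (of_space u)) \<longlongrightarrow> 0) (at u)"
      by (simp add: eq arcosh_real_def[OF ge])
    then show "isCont of_space u"
      unfolding isCont_def by (rule iffD2[OF tendsto_dist_iff])
  qed
  then show ?thesis
    by (simp add: continuous_at_imp_continuous_on)
qed

lemma measurable_of_space [measurable]: "of_space \<in> borel_measurable borel"
  by (rule borel_measurable_continuous_onI[OF continuous_of_space])

definition hyp_vol :: "hyp3 measure" where
  "hyp_vol = distr (density lborel (\<lambda>u. ennreal (1 / sqrt (1 + u \<bullet> u)))) borel of_space"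

definition hyp_plane :: "hyp3 set \<Rightarrow> bool" where
  "hyp_plane P \<longleftrightarrow> P \<noteq> {} \<and> (\<exists>W. subspace W \<and> dim W = 3 \<and> P = {x. coords x \<in> W})"

definition half_space :: "hyp3 set" where
  "half_space = {x. 0 \<le> snd (coords x) $ 1}"

definition half_space_boundary :: "hyp3 set" where
  "half_space_boundary = {x. snd (coords x) $ 1 = 0}"


section \<open>Paths in metric spaces\<close>

text \<open>Geodesics are parametrized proportionally to arc length on \<open>[0, 1]\<close>.\<close>

definition geodesic_path :: "(real \<Rightarrow> 'a::metric_space) \<Rightarrow> bool" where
  "geodesic_path g \<longleftrightarrow>
     (\<forall>s\<in>{0..1}. \<forall>t\<in>{0..1}. dist (g s) (g t) = \<bar>s - t\<bar> * dist (pathstart g) (pathfinish g))"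

definition geodesically_convex :: "'a::metric_space set \<Rightarrow> bool" where
  "geodesically_convex S \<longleftrightarrow>
     (\<forall>g. geodesic_path g \<and> pathstart g \<in> S \<and> pathfinish g \<in> S \<longrightarrow> path_image g \<subseteq> S)"

definition curve_length :: "(real \<Rightarrow> 'a::metric_space) \<Rightarrow> ereal" where
  "curve_length g =
     (SUP ts\<in>{ts. sorted ts \<and> set ts \<subseteq> {0..1}}.
        ereal (\<Sum>i<length ts - 1. dist (g (ts ! i)) (g (ts ! Suc i))))"

definition length_space :: "'a::metric_space set \<Rightarrow> bool" where
  "length_space S \<longleftrightarrow>
     (\<forall>x\<in>S. \<forall>y\<in>S. ereal (dist x y) =
        (INF g\<in>{g. path g \<and> path_image g \<subseteq> S \<and> pathstart g = x \<and> pathfinish g = y}.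
           curve_length g))"

definition same_unoriented_path :: "(real \<Rightarrow> 'a::topological_space) \<Rightarrow> (real \<Rightarrow> 'a) \<Rightarrow> bool" where
  "same_unoriented_path c d \<longleftrightarrow>
     (\<forall>t\<in>{0..1}. c t = d t) \<or> (\<forall>t\<in>{0..1}. c t = reversepath d t)"


section \<open>Hyperbolic 3-manifolds with totally geodesic boundary\<close>

text \<open>A hyperbolic 3-manifold with (possibly empty) totally geodesic boundary is a set \<open>N\<close> in a
  metric space whose induced metric is the Riemannian distance of \<open>N\<close>: it is a length metric which is
  locally isometric to a closed half-space of hyperbolic 3-space. Charts around interior points of
  \<open>N\<close> have their image in the interior of the half-space.\<close>

definition hyp_chart :: "'n::metric_space set \<Rightarrow> 'n set \<Rightarrow> ('n \<Rightarrow> hyp3) \<Rightarrow> bool" where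
  "hyp_chart N U \<phi> \<longleftrightarrow>
     openin (top_of_set N) U \<and> openin (top_of_set half_space) (\<phi> ` U) \<and>
     (\<forall>x\<in>U. \<forall>y\<in>U. dist (\<phi> x) (\<phi> y) = dist x y)"

definition hyperbolic_3_manifold :: "'n::metric_space set \<Rightarrow> bool" where
  "hyperbolic_3_manifold N \<longleftrightarrow>
     N \<noteq> {} \<and> connected N \<and> complete N \<and> length_space N \<and>
     (\<forall>x\<in>N. \<exists>U \<phi>. x \<in> U \<and> hyp_chart N U \<phi>)"

definition mfd_boundary :: "'n::metric_space set \<Rightarrow> 'n set" where
  "mfd_boundary N = {x. \<exists>U \<phi>. x \<in> U \<and> hyp_chart N U \<phi> \<and> \<phi> x \<in> half_space_boundary}"

text \<open>The hyperbolic volume on \<open>N\<close> is the unique Borel measure that all charts map to the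
  hyperbolic volume.\<close>

definition is_volume :: "'n::metric_space set \<Rightarrow> 'n measure \<Rightarrow> bool" where
  "is_volume N \<mu> \<longleftrightarrow>
     sets \<mu> = sets (restrict_space borel N) \<and>
     (\<forall>U \<phi> A. hyp_chart N U \<phi> \<and> A \<in> sets \<mu> \<and> A \<subseteq> U \<longrightarrow>
        emeasure \<mu> A = emeasure hyp_vol (\<phi> ` A))"

definition finite_volume :: "'n::metric_space set \<Rightarrow> bool" where
  "finite_volume N \<longleftrightarrow> (\<exists>\<mu>. is_volume N \<mu> \<and> emeasure \<mu> N < \<infinity>)"

text \<open>The universal cover \<open>X\<close> of \<open>N\<close>, realized as a convex subset of hyperbolic 3-space bounded by
  totally geodesic planes; the boundary of \<open>X\<close> is its topological frontier.\<close>

definition hyp_universal_cover ::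
    "hyp3 set \<Rightarrow> (hyp3 \<Rightarrow> 'n::metric_space) \<Rightarrow> 'n set \<Rightarrow> bool" where
  "hyp_universal_cover X p N \<longleftrightarrow>
     closed X \<and> interior X \<noteq> {} \<and> geodesically_convex X \<and>
     (\<forall>A\<in>components (frontier X). hyp_plane A) \<and>
     simply_connected X \<and> covering_space X p N \<and>
     (\<forall>x\<in>X. \<exists>r>0. \<forall>y\<in>ball x r \<inter> X. \<forall>z\<in>ball x r \<inter> X. dist (p y) (p z) = dist y z)"


section \<open>Short cuts, return paths and hexagons\<close>

definition short_cut_between :: "hyp3 set \<Rightarrow> hyp3 set \<Rightarrow> (real \<Rightarrow> hyp3) \<Rightarrow> bool" where
  "short_cut_between A B g \<longleftrightarrow>
     geodesic_path g \<and> pathstart g \<in> A \<and> pathfinish g \<in> B \<and>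
     (\<forall>a\<in>A. \<forall>b\<in>B. dist (pathstart g) (pathfinish g) \<le> dist a b)"

definition short_cut :: "hyp3 set \<Rightarrow> (real \<Rightarrow> hyp3) \<Rightarrow> bool" where
  "short_cut X g \<longleftrightarrow>
     (\<exists>A\<in>components (frontier X). \<exists>B\<in>components (frontier X).
        A \<noteq> B \<and> short_cut_between A B g)"

definition return_path :: "hyp3 set \<Rightarrow> (hyp3 \<Rightarrow> 'n::metric_space) \<Rightarrow> (real \<Rightarrow> 'n) \<Rightarrow> bool" where
  "return_path X p c \<longleftrightarrow> (\<exists>g. short_cut X g \<and> c = p \<circ> g)"

text \<open>\<open>lam 1, lam 2, \<dots>\<close> lists the return paths, up to reversal, without repetition and in order of
  nondecreasing length. Values of a path outside \<open>[0, 1]\<close> and \<open>lam 0\<close> are irrelevant.\<close>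

definition return_path_enumeration ::
    "hyp3 set \<Rightarrow> (hyp3 \<Rightarrow> 'n::metric_space) \<Rightarrow> (nat \<Rightarrow> real \<Rightarrow> 'n) \<Rightarrow> bool" where
  "return_path_enumeration X p lam \<longleftrightarrow>
     (\<forall>i\<ge>1. return_path X p (lam i)) \<and>
     (\<forall>c. return_path X p c \<longrightarrow> (\<exists>!i. i \<ge> 1 \<and> same_unoriented_path c (lam i))) \<and>
     (\<forall>i j. 1 \<le> i \<and> i \<le> j \<longrightarrow> curve_length (lam i) \<le> curve_length (lam j))"

text \<open>Lifts are recorded as arcs, that is, as subsets of \<open>X\<close>.\<close>

definition lifts :: "hyp3 set \<Rightarrow> (hyp3 \<Rightarrow> 'n::metric_space) \<Rightarrow> (real \<Rightarrow> 'n) \<Rightarrow> hyp3 set set" where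
  "lifts X p c =
     {path_image l | l. path l \<and> path_image l \<subseteq> X \<and> (\<forall>t\<in>{0..1}. p (l t) = c t)}"

text \<open>The filled hexagon \<open>C\<close> with internal edges \<open>e12\<close>, \<open>e23\<close>, \<open>e31\<close>. Its external edges are the images
  of \<open>h1\<close>, \<open>h2\<close>, \<open>h3\<close>, and \<open>C\<close> consists of the six edges and of the region they enclose in the
  plane \<open>P\<close>.\<close>

definition hexagon ::
    "hyp3 set \<Rightarrow> hyp3 set \<Rightarrow> hyp3 set \<Rightarrow> hyp3 set \<Rightarrow> hyp3 set \<Rightarrow> bool" where
  "hexagon X C e12 e23 e31 \<longleftrightarrow>
     (\<exists>A1 A2 A3 g12 g23 g31 h1 h2 h3 P E.
        {A1, A2, A3} \<subseteq> components (frontier X) \<and> A1 \<noteq> A2 \<and> A2 \<noteq> A3 \<and> A3 \<noteq> A1 \<and>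
        short_cut_between A1 A2 g12 \<and> e12 = path_image g12 \<and>
        short_cut_between A2 A3 g23 \<and> e23 = path_image g23 \<and>
        short_cut_between A3 A1 g31 \<and> e31 = path_image g31 \<and>
        geodesic_path h1 \<and> path_image h1 \<subseteq> A1 \<and>
          pathstart h1 = pathfinish g31 \<and> pathfinish h1 = pathstart g12 \<and>
        geodesic_path h2 \<and> path_image h2 \<subseteq> A2 \<and>
          pathstart h2 = pathfinish g12 \<and> pathfinish h2 = pathstart g23 \<and>
        geodesic_path h3 \<and> path_image h3 \<subseteq> A3 \<and>
          pathstart h3 = pathfinish g23 \<and> pathfinish h3 = pathstart g31 \<and>
        E = e12 \<union> e23 \<union> e31 \<union> path_image h1 \<union> path_image h2 \<union> path_image h3 \<and>
        hyp_plane P \<and> E \<subseteq> P \<and>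
        C = E \<union> {x \<in> P - E. bounded (connected_component_set (P - E) x)})"

definition ijk_hexagon ::
    "hyp3 set \<Rightarrow> (hyp3 \<Rightarrow> 'n::metric_space) \<Rightarrow> (nat \<Rightarrow> real \<Rightarrow> 'n) \<Rightarrow> nat \<Rightarrow> nat \<Rightarrow> nat \<Rightarrow>
     hyp3 set \<Rightarrow> hyp3 set \<Rightarrow> hyp3 set \<Rightarrow> hyp3 set \<Rightarrow> bool" where
  "ijk_hexagon X p lam i j k C e1 e2 e3 \<longleftrightarrow>
     hexagon X C e1 e2 e3 \<and>
     e1 \<in> lifts X p (lam i) \<and> e2 \<in> lifts X p (lam j) \<and> e3 \<in> lifts X p (lam k)"

end

theory Submission
  imports Defs
begin

text \<open>Write \<open>c = cosh \<ell>\<^sub>1\<close> and let \<open>\<nu>\<^sub>A\<close> be the outward unit normal of a component \<open>A\<close> of the frontier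
  of \<open>X\<close>. Compactness of the boundary of \<open>N\<close> keeps distinct components a definite distance apart, so any two
  of them are joined by a short cut and \<open>\<langle>\<nu>\<^sub>A, \<nu>\<^sub>B\<rangle> \<le> - c\<close>, with equality exactly when that short cut
  has length \<open>\<ell>\<^sub>1\<close>. A point of a lift of \<open>\<lambda>\<^sub>1\<close> between \<open>A\<close> and \<open>B\<close> is a positive combination of
  \<open>\<nu>\<^sub>A, \<nu>\<^sub>B\<close>, and a point of the hexagon is a nonnegative combination of its three normals. If both
  represent the same point and do not cancel, moving common terms to one side gives a vector
  \<open>y = \<Sum>\<^sub>I a\<^sub>i \<nu>\<^sub>i = \<Sum>\<^sub>J b\<^sub>j \<nu>\<^sub>j\<close> with disjoint \<open>I\<close>, \<open>J\<close> and positive coefficients of sums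
  \<open>S\<close> and \<open>T\<close>. The mixed products give \<open>- \<langle>y, y\<rangle> \<ge> c S T\<close>, while expanding either sum alone
  gives \<open>- \<langle>y, y\<rangle> < c S\<^sup>2\<close> and \<open>- \<langle>y, y\<rangle> < c T\<^sup>2\<close>, a contradiction.\<close>

section \<open>Geodesics in the hyperboloid model\<close>

text \<open>Working with normals avoids all cases on the position of the arc relative to the plane
  of \<open>C\<close>: the arc may cross it, lie in it or end on an edge, and only products of
  normals matter. The strictness of the two upper bounds comes from the diagonal: with pairwise
  products \<open>- c\<close>, the square of a sum is \<open>1 + c\<close> times the sum of the
  squared coefficients minus \<open>c\<close> times the square of their sum. If the two walls of the
  arc are among the three of the hexagon, the arc is an internal edge because a common perpendicular
  is unique. The geometric obstacle is that \<open>lam 1\<close> lives in \<open>N\<close>, where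
  geodesics minimise only locally. Its lifts must be recognised as local geodesics of hyperbolic
  space, hence geodesics, which join two different walls; that they are short cuts then follows from
  the minimality of their length.\<close>

lemma mink_minus: "mink (- u) w = - mink u w" "mink w (- u) = - mink w u"
  by (simp_all add: mink_def)

lemma mink_zero: "mink 0 w = 0" "mink w 0 = 0"
  by (simp_all add: mink_def)

lemma mink_sum: "mink (sum f S) w = (\<Sum>i\<in>S. mink (f i) w)" "mink w (sum f S) = (\<Sum>i\<in>S. mink w (f i))"
  by (induction S rule: infinite_finite_induct) (simp_all add: mink_zero mink_add)

lemmas mink_bilinear = mink_add mink_diff mink_scale mink_minus

text \<open>Reflecting the time coordinate of \<open>v\<close> gives a test vector whose product
  with \<open>v\<close> is the Euclidean square of \<open>v\<close>.\<close>

lemma mink_nondegenerate: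
  assumes "\<And>w. mink v w = 0"
  shows "v = 0"
proof -
  have "mink v (- fst v, snd v) = 0" using assms .
  then have "snd v \<bullet> snd v + fst v * fst v = 0" by (simp add: mink_def)
  then have "snd v = 0 \<and> fst v = 0"
    by (metis add_nonneg_eq_0_iff inner_eq_zero_iff inner_ge_zero mult_eq_0_iff zero_le_square)
  then show ?thesis by (simp add: prod_eq_iff)
qed

text \<open>Serves as an equality test: two vectors agree once their difference is orthogonal to
  some point and has square zero.\<close>

lemma mink_orthogonal_null:
  assumes "mink w (coords y) = 0" "mink w w = 0"
  shows "w = 0"
proof -
  define s u t v where "s = fst w" "u = snd w" "t = fst (coords y)" "v = snd (coords y)"
  note d = this
  have 1: "u \<bullet> v = s * t" and 2: "u \<bullet> u = s\<^sup>2" and 3: "t\<^sup>2 = 1 + v \<bullet> v"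
    using assms mink_coords_self[of y] by (simp_all add: mink_def d power2_eq_square)
  have "(u \<bullet> v)\<^sup>2 \<le> (u \<bullet> u) * (v \<bullet> v)"
    by (rule Cauchy_Schwarz_ineq)
  then have "s\<^sup>2 \<le> 0"
    by (simp add: 1 2 3 power_mult_distrib algebra_simps)
  then have "s = 0" "u = 0" using 2 by simp_all
  then show "w = 0" by (simp add: d prod_eq_iff)
qed

lemma mink_orthogonal_pos:
  assumes "mink w (coords y) = 0" "w \<noteq> 0"
  shows "mink w w > 0"
  using mink_orthogonal_nonneg[OF assms(1)] mink_orthogonal_null[OF assms(1)] assms(2) by fastforce

lemma cosh_dist: "cosh (dist x y) = - mink (coords x) (coords y)"
  using mink_coords_le[of x y] by (simp add: dist_hyp3_def)

text \<open>On the lower sheet the negative of \<open>v\<close> would be a point, and products of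
  points are at most -1, so \<open>v\<close> would have a positive product with
  \<open>y\<close>.\<close>

lemma coords_surj:
  assumes "mink v v = - 1" "mink v (coords y) < 0"
  obtains x where "coords x = v"
proof -
  have nz: "fst v \<noteq> 0"
    using assms(1) by (auto simp: mink_def) (metis inner_ge_zero neg_0_le_iff_le not_one_le_zero)
  have "fst v > 0"
  proof (rule ccontr)
    assume "\<not> fst v > 0"
    then have "- v \<in> {v. mink v v = - 1 \<and> fst v > 0}"
      using nz assms(1) by (simp add: mink_minus)
    then have "coords (hyp3 (- v)) = - v" by (rule hyp3_inverse)
    then have "mink (- v) (coords y) \<le> - 1" using mink_coords_le[of "hyp3 (- v)" y] by simp
    then show False using assms(2) by (simp add: mink_minus)
  qed
  then have "coords (hyp3 v) = v" using assms(1) by (simp add: hyp3_inverse)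
  then show thesis using that by blast
qed

lemma timelike_scaled_coords:
  assumes "mink v v < 0" "mink v (coords y) < 0"
  obtains x where "v = sqrt (- mink v v) *\<^sub>R coords x"
proof -
  define r where "r = sqrt (- mink v v)"
  have r: "r > 0" "r * r = - mink v v" using assms(1) by (simp_all add: r_def)
  have "mink ((1/r) *\<^sub>R v) ((1/r) *\<^sub>R v) = (1/r) * ((1/r) * mink v v)" by (simp add: mink_scale)
  also have "\<dots> = - (r * r) / (r * r)" by (simp add: r(2))
  also have "\<dots> = - 1" using r(1) by simp
  finally have "mink ((1/r) *\<^sub>R v) ((1/r) *\<^sub>R v) = - 1" .
  moreover have "mink ((1/r) *\<^sub>R v) (coords y) < 0"
    using r assms(2) by (simp add: mink_scale divide_neg_pos)
  ultimately obtain x where "coords x = (1/r) *\<^sub>R v" by (rule coords_surj)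
  then have "v = r *\<^sub>R coords x" using r by simp
  then show thesis using that by (simp add: r_def)
qed

text \<open>The topology of \<open>hyp3\<close> comes from the distance, so continuity of products
  has to be read off distances. \<open>cosh_dist\<close> does this for products with points, hence
  it is enough to write every vector as a combination of two points.\<close>

lemma vector_eq_diff_coords:
  obtains a b x y where "v = a *\<^sub>R coords x - b *\<^sub>R coords y"
proof -
  define o0 where "o0 = of_space 0"
  have o0: "coords o0 = (1, 0)" by (simp add: o0_def coords_of_space)
  \<comment> \<open>This multiple of the base point pushes \<open>v\<close> into the open future
    cone.\<close>
  define b where "b = norm (snd v) + \<bar>fst v\<bar> + 1"
  define w where "w = v + b *\<^sub>R coords o0"
  have w: "fst w = fst v + b" "snd w = snd v" by (simp_all add: w_def o0)
  have gt: "norm (snd w) < fst w" "0 < fst w" using norm_ge_zero[of "snd v"] by (simp_all add: w b_def; linarith)+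
  have "snd w \<bullet> snd w < fst w * fst w"
    using gt by (metis mult_strict_mono' norm_ge_zero power2_eq_square power2_norm_eq_inner)
  then have "mink w w < 0" by (simp add: mink_def)
  moreover have "mink w (coords o0) < 0" using gt by (simp add: mink_def o0)
  ultimately obtain x where "w = sqrt (- mink w w) *\<^sub>R coords x" by (rule timelike_scaled_coords)
  then have "v = sqrt (- mink w w) *\<^sub>R coords x - b *\<^sub>R coords o0" by (metis add_diff_cancel w_def)
  then show thesis by (rule that)
qed

lemma continuous_on_mink [continuous_intros]:
  assumes "continuous_on S f"
  shows "continuous_on S (\<lambda>x. mink (coords (f x)) v)"
proof -
  obtain a b y z where v: "v = a *\<^sub>R coords y - b *\<^sub>R coords z" by (rule vector_eq_diff_coords)
  have "(\<lambda>x. mink (coords (f x)) v) = (\<lambda>x. b * cosh (dist (f x) z) - a * cosh (dist (f x) y))"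
    by (simp add: v mink_bilinear cosh_dist)
  moreover have "continuous_on S (\<lambda>x. b * cosh (dist (f x) z) - a * cosh (dist (f x) y))"
    by (intro continuous_intros assms)
  ultimately show ?thesis by (simp only:)
qed

section \<open>Rays, segments and local geodesics in Lorentz coordinates\<close>

lemma coords_ray:
  assumes "mink u u = 1" "mink (coords x) u = 0"
  obtains \<gamma> where "\<And>s. coords (\<gamma> s) = cosh s *\<^sub>R coords x + sinh s *\<^sub>R u"
    "\<And>s t. dist (\<gamma> s) (\<gamma> t) = \<bar>s - t\<bar>"
proof -
  have u: "mink u (coords x) = 0" using assms(2) by (simp add: mink_commute)
  have mm: "mink (cosh s *\<^sub>R coords x + sinh s *\<^sub>R u) (cosh t *\<^sub>R coords x + sinh t *\<^sub>R u) = - cosh (s - t)" for s t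
    by (simp add: mink_bilinear assms u mink_coords_self cosh_diff)
  have "\<exists>y. coords y = cosh s *\<^sub>R coords x + sinh s *\<^sub>R u" for s
  proof -
    have "mink (cosh s *\<^sub>R coords x + sinh s *\<^sub>R u) (coords x) < 0"
      by (simp add: mink_bilinear u mink_coords_self cosh_real_pos)
    moreover have "mink (cosh s *\<^sub>R coords x + sinh s *\<^sub>R u) (cosh s *\<^sub>R coords x + sinh s *\<^sub>R u) = - 1"
      by (simp add: mm)
    ultimately show ?thesis by (metis coords_surj)
  qed
  then obtain \<gamma> where g: "\<And>s. coords (\<gamma> s) = cosh s *\<^sub>R coords x + sinh s *\<^sub>R u" by metis
  have "dist (\<gamma> s) (\<gamma> t) = \<bar>s - t\<bar>" for s t
  proof -
    have "cosh (dist (\<gamma> s) (\<gamma> t)) = cosh \<bar>s - t\<bar>" by (simp add: cosh_dist g mm)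
    then show ?thesis using cosh_real_nonneg_le_iff[of "dist (\<gamma> s) (\<gamma> t)" "\<bar>s - t\<bar>"]
        cosh_real_nonneg_le_iff[of "\<bar>s - t\<bar>" "dist (\<gamma> s) (\<gamma> t)"] by simp
  qed
  then show thesis using that g by blast
qed

lemma unit_tangent:
  assumes "x \<noteq> y"
  obtains u where "mink u u = 1" "mink (coords x) u = 0"
    "coords y = cosh (dist x y) *\<^sub>R coords x + sinh (dist x y) *\<^sub>R u"
proof -
  define d where "d = dist x y"
  have s: "sinh d > 0" using assms by (simp add: d_def)
  have c: "mink (coords x) (coords y) = - cosh d" by (simp add: d_def cosh_dist)
  define w where "w = coords y - cosh d *\<^sub>R coords x"
  have ww: "mink w w = (sinh d)\<^sup>2"
    by (simp add: w_def mink_bilinear c mink_coords_self mink_commute[of "coords y" "coords x"] sinh_square_eq)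
      (simp add: power2_eq_square)
  have wx: "mink (coords x) w = 0"
    by (simp add: w_def mink_bilinear c mink_coords_self)
  have 1: "mink ((1 / sinh d) *\<^sub>R w) ((1 / sinh d) *\<^sub>R w) = 1"
    using s by (simp add: mink_scale ww power2_eq_square)
  have 2: "mink (coords x) ((1 / sinh d) *\<^sub>R w) = 0" by (simp add: mink_scale wx)
  have 3: "coords y = cosh d *\<^sub>R coords x + sinh d *\<^sub>R ((1 / sinh d) *\<^sub>R w)"
    using s by (simp add: w_def)
  show thesis using 1 2 3 by (rule that[unfolded d_def[symmetric]])
qed

lemma geodesic_path_exists:
  obtains g :: "real \<Rightarrow> hyp3" where "geodesic_path g" "pathstart g = x" "pathfinish g = y"
proof (cases "x = y")
  case True
  have "geodesic_path (\<lambda>_. x)" by (simp add: geodesic_path_def pathstart_def pathfinish_def)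
  then show thesis using that[of "\<lambda>_. x"] True by (simp add: pathstart_def pathfinish_def)
next
  case False
  then obtain u where u: "mink u u = 1" "mink (coords x) u = 0"
    "coords y = cosh (dist x y) *\<^sub>R coords x + sinh (dist x y) *\<^sub>R u" by (rule unit_tangent)
  obtain \<gamma> where g: "\<And>s. coords (\<gamma> s) = cosh s *\<^sub>R coords x + sinh s *\<^sub>R u"
    "\<And>s t. dist (\<gamma> s) (\<gamma> t) = \<bar>s - t\<bar>" using coords_ray[OF u(1,2)] by blast
  define h where "h t = \<gamma> (t * dist x y)" for t
  have "h 0 = x" "h 1 = y" using g(1)[of 0] g(1)[of "dist x y"] u(3) by (simp_all add: h_def flip: coords_inject)
  moreover from this have "geodesic_path h"
    by (simp add: geodesic_path_def pathstart_def pathfinish_def) (simp add: h_def g abs_mult flip: left_diff_distrib)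
  ultimately show thesis using that by (simp add: pathstart_def pathfinish_def)
qed

lemma geodesic_path_dist:
  assumes "geodesic_path g" "s \<in> {0..1}" "t \<in> {0..1}"
  shows "dist (g s) (g t) = \<bar>s - t\<bar> * dist (pathstart g) (pathfinish g)"
  by (rule bspec[OF bspec[OF assms(1)[unfolded geodesic_path_def] assms(2)] assms(3)])

text \<open>The hyperbolic counterpart of spherical linear interpolation, multiplied through by
  \<open>sinh d\<close> so as to include constant paths. A geodesic path is given by distances
  alone, so its vectors are recovered from their products with the two ends.\<close>

lemma geodesic_path_coords:
  fixes g :: "real \<Rightarrow> hyp3"
  assumes "geodesic_path g" "t \<in> {0..1}"
  defines "d \<equiv> dist (pathstart g) (pathfinish g)"
  shows "sinh d *\<^sub>R coords (g t) =
    sinh ((1 - t) * d) *\<^sub>R coords (pathstart g) + sinh (t * d) *\<^sub>R coords (pathfinish g)"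
proof (cases "d = 0")
  case False
  define x y z where "x = coords (pathstart g)" "y = coords (pathfinish g)" "z = coords (g t)"
  note xyz = this
  have s: "sinh d > 0" using False zero_le_dist[of "pathstart g" "pathfinish g"] by (simp add: d_def)
  have 1: "dist (g t) (pathstart g) = t * d" "dist (g t) (pathfinish g) = (1 - t) * d"
    using geodesic_path_dist[OF assms(1,2), of 0] geodesic_path_dist[OF assms(1,2), of 1] assms(2)
    by (simp_all add: d_def) (simp_all add: pathstart_def pathfinish_def)
  have xx: "mink x x = - 1" "mink y y = - 1" "mink z z = - 1" by (simp_all add: xyz mink_coords_self)
  have xy: "mink x y = - cosh d" "mink y x = - cosh d"
    using cosh_dist[of "pathstart g" "pathfinish g"] by (simp_all add: xyz d_def mink_commute)
  have zx: "mink z x = - cosh (t * d)" "mink z y = - cosh ((1 - t) * d)"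
    "mink x z = - cosh (t * d)" "mink y z = - cosh ((1 - t) * d)"
    using cosh_dist[of "g t" "pathstart g"] cosh_dist[of "g t" "pathfinish g"]
    by (simp_all add: xyz 1 mink_commute)
  define p q where "p = (1 - t) * d" "q = t * d"
  have pq: "d = p + q" by (simp add: p_q_def algebra_simps)
  \<comment> \<open>The difference of the two sides; it is orthogonal to \<open>z\<close> and has
    square zero.\<close>
  define w where "w = sinh p *\<^sub>R x + sinh q *\<^sub>R y - sinh d *\<^sub>R z"
  have wz: "mink w z = 0"
    by (simp add: w_def mink_bilinear zx xx flip: p_q_def) (simp add: pq sinh_add)
  have cp: "cosh a * cosh a = 1 + sinh a * sinh a" for a :: real
    using cosh_square_eq[of a] by (simp add: power2_eq_square)
  have "mink w w = mink w (sinh p *\<^sub>R x + sinh q *\<^sub>R y)"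
    by (subst (2) w_def) (simp add: mink_diff(2) mink_scale wz)
  also have "\<dots> = sinh d * (sinh p * cosh q + sinh q * cosh p)
       - (sinh p * sinh p + sinh q * sinh q + 2 * sinh p * sinh q * cosh d)"
    unfolding w_def mink_bilinear xx xy zx p_q_def[symmetric] by (simp add: algebra_simps)
  also have "\<dots> = sinh p * sinh p * (cosh q * cosh q - 1 - sinh q * sinh q) + sinh q * sinh q * (cosh p * cosh p - 1 - sinh p * sinh p)"
    by (simp add: pq sinh_add cosh_add algebra_simps)
  also have "\<dots> = 0" by (simp add: cp)
  finally have "w = 0" using mink_orthogonal_null[of w "g t"] wz by (simp add: xyz)
  then show ?thesis by (simp add: w_def p_q_def xyz)
qed simp

text \<open>Turns segments into linear algebra: a subspace or convex cone containing both end
  vectors contains the whole segment.\<close>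

lemma geodesic_path_conic:
  fixes g :: "real \<Rightarrow> hyp3"
  assumes "geodesic_path g" "z \<in> path_image g"
  obtains a b where "a \<ge> 0" "b \<ge> 0" "coords z = a *\<^sub>R coords (pathstart g) + b *\<^sub>R coords (pathfinish g)"
proof -
  obtain t where t: "t \<in> {0..1}" "z = g t" using assms(2) by (auto simp: path_image_def)
  define d where "d = dist (pathstart g) (pathfinish g)"
  have d0: "d \<ge> 0" by (simp add: d_def)
  show thesis
  proof (cases "d = 0")
    case True
    then have "dist (g t) (g 0) = 0" using geodesic_path_dist[OF assms(1) t(1), of 0] by (simp add: d_def)
    then have "coords z = 1 *\<^sub>R coords (pathstart g) + 0 *\<^sub>R coords (pathfinish g)" by (simp add: t pathstart_def)
    then show thesis using that[of 1 0] by simp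
  next
    case False
    then have s: "sinh d > 0" using d0 by simp
    have "coords z = (1 / sinh d) *\<^sub>R (sinh d *\<^sub>R coords (g t))" using s t by simp
    also have "\<dots> = (sinh ((1 - t) * d) / sinh d) *\<^sub>R coords (pathstart g) + (sinh (t * d) / sinh d) *\<^sub>R coords (pathfinish g)"
      unfolding d_def geodesic_path_coords[OF assms(1) t(1)] by (simp add: scaleR_add_right)
    finally show thesis
      using that[of "sinh ((1 - t) * d) / sinh d" "sinh (t * d) / sinh d"] s t d0 by simp
  qed
qed

lemma geodesic_path_unique:
  fixes g h :: "real \<Rightarrow> hyp3"
  assumes "geodesic_path g" "geodesic_path h" "pathstart g = pathstart h" "pathfinish g = pathfinish h" "t \<in> {0..1}"
  shows "g t = h t"
proof (cases "pathstart g = pathfinish g")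
  case True
  have "dist (g t) (g 0) = 0" "dist (h t) (h 0) = 0"
    using geodesic_path_dist[OF assms(1,5), of 0] geodesic_path_dist[OF assms(2,5), of 0] assms(3,4) True
    by simp_all
  then show ?thesis using assms(3) by (simp add: pathstart_def)
next
  case False
  then have "sinh (dist (pathstart g) (pathfinish g)) \<noteq> 0" by simp
  then show ?thesis
    using geodesic_path_coords[OF assms(1,5)] geodesic_path_coords[OF assms(2,5)]
    unfolding assms(3,4) by (metis coords_inject scaleR_cancel_left)
qed

lemma geodesic_path_reversepath:
  assumes "geodesic_path g"
  shows "geodesic_path (reversepath g)"
  unfolding geodesic_path_def pathstart_reversepath pathfinish_reversepath
proof (intro ballI)
  fix s t :: real assume "s \<in> {0..1}" "t \<in> {0..1}"
  then show "dist (reversepath g s) (reversepath g t) = \<bar>s - t\<bar> * dist (pathfinish g) (pathstart g)"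
    using geodesic_path_dist[OF assms, of "1 - s" "1 - t"]
    by (simp add: reversepath_def dist_commute abs_minus_commute)
qed

lemma path_image_geodesic_unique:
  fixes g h :: "real \<Rightarrow> hyp3"
  assumes "geodesic_path g" "geodesic_path h"
    "pathstart g = pathstart h \<and> pathfinish g = pathfinish h \<or> pathstart g = pathfinish h \<and> pathfinish g = pathstart h"
  shows "path_image g = path_image h"
proof -
  have *: "path_image g = path_image h" if "geodesic_path g" "geodesic_path h"
    "pathstart g = pathstart h" "pathfinish g = pathfinish h" for g h :: "real \<Rightarrow> hyp3"
    unfolding path_image_def using geodesic_path_unique[OF that] by (intro image_cong) auto
  show ?thesis
    using *[OF assms(1,2)] *[OF assms(1) geodesic_path_reversepath[OF assms(2)]] assms(3) by auto
qed

lemma geodesic_path_imp_path: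
  assumes "geodesic_path g"
  shows "path g"
proof -
  have "(dist (pathstart g) (pathfinish g))-lipschitz_on {0..1} g"
    using assms by (intro lipschitz_onI) (auto simp: geodesic_path_def dist_real_def mult.commute)
  then show ?thesis unfolding path_def by (rule lipschitz_on_continuous_on)
qed

text \<open>The ratio of the two coefficients takes every value along the path, so some
  \<open>g t\<close> is proportional to \<open>z\<close>; proportional points of the hyperboloid
  coincide.\<close>

lemma conic_in_geodesic_path:
  fixes g :: "real \<Rightarrow> hyp3"
  assumes "geodesic_path g" "a \<ge> 0" "b \<ge> 0"
    "coords z = a *\<^sub>R coords (pathstart g) + b *\<^sub>R coords (pathfinish g)"
  shows "z \<in> path_image g"
proof -
  define d where "d = dist (pathstart g) (pathfinish g)"
  have d0: "d \<ge> 0" by (simp add: d_def)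
  have scal: "v = w" if "coords v = r *\<^sub>R coords w" "r > 0" for v w r
  proof -
    have "mink (coords v) (coords v) = r * r * mink (coords w) (coords w)" by (simp add: that mink_scale)
    then have "r * r = 1" by (simp add: mink_coords_self)
    then have "r = 1" using \<open>r > 0\<close> by (metis abs_of_pos mult_1 real_sqrt_abs2 real_sqrt_one)
    then show ?thesis using that by (simp add: coords_inject)
  qed
  have ab: "a + b > 0"
  proof (rule ccontr)
    assume "\<not> a + b > 0"
    then have "a = 0" "b = 0" using assms(2,3) by auto
    then have "coords z = 0" using assms(4) by simp
    then show False using mink_coords_self[of z] by (simp add: mink_zero)
  qed
  show ?thesis
  proof (cases "d = 0")
    case True
    then have "coords z = (a + b) *\<^sub>R coords (pathstart g)" using assms(4) by (simp add: d_def scaleR_add_left)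
    then have "z = pathstart g" using scal ab by blast
    then show ?thesis by (simp add: pathstart_in_path_image)
  next
    case False
    then have s: "sinh d > 0" using d0 by simp
    \<comment> \<open>At a zero of \<open>f\<close> the coefficients of \<open>g t\<close> are in
      the ratio \<open>a : b\<close>.\<close>
    define f where "f t = a * sinh (t * d) - b * sinh ((1 - t) * d)" for t
    have "\<exists>t\<ge>0. t \<le> 1 \<and> f t = 0"
    proof (rule IVT')
      show "f 0 \<le> 0" "0 \<le> f 1" using assms s by (simp_all add: f_def)
      show "continuous_on {0..1} f" unfolding f_def by (intro continuous_intros)
    qed simp
    then obtain t where t: "t \<in> {0..1}" "a * sinh (t * d) = b * sinh ((1 - t) * d)"
      by (auto simp: f_def)
    define p q where "p = sinh ((1 - t) * d)" "q = sinh (t * d)"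
    have pq: "p \<ge> 0" "q \<ge> 0" using t d0 by (simp_all add: p_q_def)
    have pq0: "p + q > 0"
    proof (rule ccontr)
      assume "\<not> p + q > 0"
      then have "p = 0" "q = 0" using pq by auto
      then show False using False by (auto simp: p_q_def)
    qed
    have e: "a * q = b * p" using t by (simp add: p_q_def)
    have G: "sinh d *\<^sub>R coords (g t) = p *\<^sub>R coords (pathstart g) + q *\<^sub>R coords (pathfinish g)"
      unfolding d_def p_q_def by (rule geodesic_path_coords[OF assms(1) t(1)])
    have "(p + q) *\<^sub>R coords z = ((p + q) * a) *\<^sub>R coords (pathstart g) + ((p + q) * b) *\<^sub>R coords (pathfinish g)"
      by (simp add: assms(4) scaleR_add_right)
    also have "(p + q) * a = (a + b) * p" using e by (simp add: algebra_simps)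
    also have "(p + q) * b = (a + b) * q" using e by (simp add: algebra_simps)
    finally have "(p + q) *\<^sub>R coords z = (a + b) *\<^sub>R (sinh d *\<^sub>R coords (g t))"
      by (simp add: G scaleR_add_right)
    then have "(1 / (p + q)) *\<^sub>R ((p + q) *\<^sub>R coords z) = (1 / (p + q)) *\<^sub>R ((a + b) *\<^sub>R (sinh d *\<^sub>R coords (g t)))"
      by simp
    then have "coords z = ((a + b) * sinh d / (p + q)) *\<^sub>R coords (g t)"
      using pq0 by simp
    moreover have "(a + b) * sinh d / (p + q) > 0" using ab s pq0 by simp
    ultimately have "z = g t" using scal by blast
    then show ?thesis using t by (auto simp: path_image_def)
  qed
qed

lemma geodesically_convex_conic:
  assumes "geodesically_convex X" "x \<in> X" "y \<in> X" "a \<ge> 0" "b \<ge> 0"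
    "coords z = a *\<^sub>R coords x + b *\<^sub>R coords y"
  shows "z \<in> X"
proof -
  obtain g where g: "geodesic_path g" "pathstart g = x" "pathfinish g = y" by (rule geodesic_path_exists)
  then have "z \<in> path_image g" using assms conic_in_geodesic_path[of g a b z] by simp
  then show ?thesis using assms g unfolding geodesically_convex_def by blast
qed

text \<open>The vectors \<open>v k\<close> of points at consecutive distances \<open>h D\<close> along a local geodesic satisfy
  \<open>v (k + 2) = 2 cosh (h D) v (k + 1) - v k\<close>, the recurrence of \<open>cosh (k h D)\<close> and \<open>sinh (k h D)\<close>.\<close>

lemma local_geodesic_imp_geodesic:
  fixes l :: "real \<Rightarrow> hyp3"
  assumes "\<delta> > 0" "D \<ge> 0"
    and loc: "\<And>s t. \<lbrakk>s \<in> {0..1}; t \<in> {0..1}; \<bar>s - t\<bar> < \<delta>\<rbrakk> \<Longrightarrow> dist (l s) (l t) = \<bar>s - t\<bar> * D"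
  shows "geodesic_path l" "dist (pathstart l) (pathfinish l) = D"
proof -
  have main: "dist (l s) (l t) = (t - s) * D" if st: "s \<in> {0..1}" "t \<in> {0..1}" "s < t" for s t
  proof (cases "D = 0")
    case False
    then have D: "D > 0" using assms by simp
    \<comment> \<open>The factor 2 keeps two consecutive steps together shorter than
      \<open>\<delta>\<close>, so the products over one and over two steps are known.\<close>
    obtain n where n: "2 * (t - s) / \<delta> < real n" using reals_Archimedean2 by blast
    have n0: "n > 0" using n st assms(1) by (metis diff_gt_0_iff_gt divide_pos_pos mult_pos_pos of_nat_0_less_iff order.strict_trans zero_less_numeral)
    define h where "h = (t - s) / n"
    have h: "h > 0" "2 * h < \<delta>" "real n * h = t - s" using n n0 st assms(1) by (simp_all add: h_def field_simps)
    define \<tau> where "\<tau> k = s + real k * h" for k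
    have tau: "\<tau> k \<in> {0..1}" if "k \<le> n" for k
    proof -
      have "real k * h \<le> real n * h" using that h by (intro mult_right_mono) auto
      then show ?thesis using st h by (auto simp: \<tau>_def)
    qed
    define v where "v k = coords (l (\<tau> k))" for k
    have d1: "dist (l (\<tau> k)) (l (\<tau> (Suc k))) = h * D" if "Suc k \<le> n" for k
      using loc[OF tau[of k] tau[of "Suc k"]] that h by (simp add: \<tau>_def algebra_simps)
    have d2: "dist (l (\<tau> k)) (l (\<tau> (Suc (Suc k)))) = 2 * h * D" if "Suc (Suc k) \<le> n" for k
      using loc[OF tau[of k] tau[of "Suc (Suc k)"]] that h by (simp add: \<tau>_def algebra_simps)
    define c where "c = cosh (h * D)"
    have m0: "mink (v k) (v k) = - 1" for k by (simp add: v_def mink_coords_self)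
    have m1: "mink (v k) (v (Suc k)) = - c" if "Suc k \<le> n" for k
      using cosh_dist[of "l (\<tau> k)" "l (\<tau> (Suc k))"] d1[OF that] by (simp add: v_def c_def)
    have m2: "mink (v k) (v (Suc (Suc k))) = 1 - 2 * c * c" if "Suc (Suc k) \<le> n" for k
      using cosh_dist[of "l (\<tau> k)" "l (\<tau> (Suc (Suc k)))"] d2[OF that] cosh_double_cosh[of "h * D"]
      by (simp add: v_def c_def power2_eq_square mult.assoc)
    have rec: "v (Suc (Suc k)) = (2 * c) *\<^sub>R v (Suc k) - v k" if "Suc (Suc k) \<le> n" for k
    proof -
      define w where "w = v k + v (Suc (Suc k)) - (2 * c) *\<^sub>R v (Suc k)"
      have k: "Suc k \<le> n" using that by simp
      note ms = m0 m1[OF k] m1[OF that] m2[OF that]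
      have "mink w (v (Suc k)) = 0"
        by (simp add: w_def mink_bilinear ms mink_commute[of "v (Suc (Suc k))" "v (Suc k)"])
      moreover have "mink w w = 0"
        by (simp add: w_def mink_bilinear ms mink_commute[of "v (Suc (Suc k))" "v (Suc k)"]
            mink_commute[of "v (Suc k)" "v k"] mink_commute[of "v (Suc (Suc k))" "v k"] algebra_simps)
      ultimately have "w = 0" using mink_orthogonal_null by (simp add: v_def)
      then show ?thesis by (simp add: w_def algebra_simps)
    qed
    have "l (\<tau> 0) \<noteq> l (\<tau> 1)" using d1[of 0] n0 h D by auto
    then obtain u where u: "mink u u = 1" "mink (v 0) u = 0" "v 1 = c *\<^sub>R v 0 + sinh (h * D) *\<^sub>R u"
      using unit_tangent[of "l (\<tau> 0)" "l (\<tau> 1)"] d1[of 0] n0 by (auto simp: v_def c_def)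
    have vk: "k \<le> n \<longrightarrow> v k = cosh (k * (h * D)) *\<^sub>R v 0 + sinh (k * (h * D)) *\<^sub>R u" for k
    proof (induction k rule: less_induct)
      case (less k)
      consider "k = 0" | "k = 1" | j where "k = Suc (Suc j)" by (metis One_nat_def not0_implies_Suc)
      then show ?case
      proof cases
        case 3
        show ?thesis
        proof
          assume kn: "k \<le> n"
          define y where "y = real j * (h * D)"
          define z where "z = h * D"
          have ih: "v j = cosh y *\<^sub>R v 0 + sinh y *\<^sub>R u" "v (Suc j) = cosh (y + z) *\<^sub>R v 0 + sinh (y + z) *\<^sub>R u"
            using less[of j] less[of "Suc j"] kn 3 by (simp_all add: y_def z_def algebra_simps)
          have cz: "c = cosh z" by (simp add: c_def z_def)
          have i1: "cosh (y + 2 * z) = 2 * cosh z * cosh (y + z) - cosh y"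
            using cosh_add[of "y + z" z] cosh_diff[of "y + z" z] by (simp add: algebra_simps)
          have i2: "sinh (y + 2 * z) = 2 * cosh z * sinh (y + z) - sinh y"
            using sinh_add[of "y + z" z] sinh_diff[of "y + z" z] by (simp add: algebra_simps)
          have "v k = (2 * c * cosh (y + z) - cosh y) *\<^sub>R v 0 + (2 * c * sinh (y + z) - sinh y) *\<^sub>R u"
            using rec[of j] kn 3 by (simp add: ih algebra_simps)
          also have "\<dots> = cosh (y + 2 * z) *\<^sub>R v 0 + sinh (y + 2 * z) *\<^sub>R u" by (simp add: i1 i2 cz)
          also have "y + 2 * z = k * (h * D)" by (simp add: y_def z_def 3 algebra_simps)
          finally show "v k = cosh (k * (h * D)) *\<^sub>R v 0 + sinh (k * (h * D)) *\<^sub>R u" .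
        qed
      qed (use u in \<open>simp_all add: c_def\<close>)
    qed
    have nh: "n * (h * D) = (t - s) * D" using h by (simp add: mult.assoc[symmetric])
    have "\<tau> 0 = s" "\<tau> n = t" using h by (simp_all add: \<tau>_def)
    then have "cosh (dist (l s) (l t)) = - mink (v 0) (v n)" by (simp add: v_def cosh_dist)
    also have "\<dots> = cosh ((t - s) * D)"
      using vk[of n] by (simp add: mink_bilinear u m0 nh)
    finally show ?thesis
      using cosh_real_nonneg_le_iff[of "dist (l s) (l t)" "(t - s) * D"]
        cosh_real_nonneg_le_iff[of "(t - s) * D" "dist (l s) (l t)"] st D by simp
  next
    case True
    have "l constant_on {0..1}"
    proof (rule locally_constant_imp_constant)
      show "connected ({0..1} :: real set)" by simp
      fix a :: real assume a: "a \<in> {0..1}"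
      show "\<exists>T. openin (top_of_set {0..1}) T \<and> a \<in> T \<and> (\<forall>x\<in>T. l x = l a)"
      proof (intro exI[of _ "{0..1} \<inter> ball a \<delta>"] conjI ballI)
        fix x assume x: "x \<in> {0..1} \<inter> ball a \<delta>"
        then have "dist (l x) (l a) = 0" using loc[of x a] a True by (auto simp: dist_real_def)
        then show "l x = l a" by simp
      qed (use a assms(1) in auto)
    qed
    then show ?thesis using True st by (auto simp: constant_on_def)
  qed
  show d: "dist (pathstart l) (pathfinish l) = D"
    using main[of 0 1] by (simp add: pathstart_def pathfinish_def)
  show "geodesic_path l"
    unfolding geodesic_path_def d
  proof (intro ballI)
    fix s t :: real assume "s \<in> {0..1}" "t \<in> {0..1}"
    then show "dist (l s) (l t) = \<bar>s - t\<bar> * D"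
      using main[of s t] main[of t s] by (cases s t rule: linorder_cases) (auto simp: dist_commute)
  qed
qed

section \<open>Isometries, planes and common perpendiculars\<close>

lemma linear_mink: "linear (\<lambda>v. mink v w)" "linear (\<lambda>w. mink v w)"
  by (intro linearI; simp add: mink_bilinear)+

text \<open>Besides \<open>coords x\<close> the span contains every tangent direction at
  \<open>x\<close>: a short step along its ray stays in the ball and differs from a multiple of
  \<open>coords x\<close> by a multiple of the direction.\<close>

lemma span_coords_ball:
  assumes "r > 0"
  shows "span (coords ` ball x r) = UNIV"
proof -
  have x: "coords x \<in> span (coords ` ball x r)"
    using assms by (intro span_base) auto
  have "v \<in> span (coords ` ball x r)" for v
  proof -
    define w where "w = v + mink v (coords x) *\<^sub>R coords x"
    have wx: "mink w (coords x) = 0" by (simp add: w_def mink_bilinear mink_coords_self)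
    have "w \<in> span (coords ` ball x r)"
    proof (cases "w = 0")
      case False
      define q where "q = sqrt (mink w w)"
      define u where "u = (1 / q) *\<^sub>R w"
      have "mink w w > 0" using mink_orthogonal_pos[OF wx False] .
      then have q: "q > 0" "mink w w = q * q" by (simp_all add: q_def)
      have u: "mink u u = 1" "mink (coords x) u = 0"
        using q wx by (simp_all add: u_def mink_scale mink_commute[of "coords x"])
      obtain \<gamma> where g: "\<And>s. coords (\<gamma> s) = cosh s *\<^sub>R coords x + sinh s *\<^sub>R u"
        "\<And>s t. dist (\<gamma> s) (\<gamma> t) = \<bar>s - t\<bar>" using coords_ray[OF u] by blast
      have "\<gamma> 0 = x" using g(1)[of 0] by (simp add: coords_inject)
      then have "\<gamma> (r / 2) \<in> ball x r" using g(2)[of 0 "r / 2"] assms by simp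
      then have "coords (\<gamma> (r / 2)) \<in> span (coords ` ball x r)" by (intro span_base) auto
      then have "coords (\<gamma> (r / 2)) - cosh (r / 2) *\<^sub>R coords x \<in> span (coords ` ball x r)"
        using x by (intro span_diff span_scale)
      then have "(q / sinh (r / 2)) *\<^sub>R (sinh (r / 2) *\<^sub>R u) \<in> span (coords ` ball x r)"
        by (intro span_scale[of "sinh (r / 2) *\<^sub>R u"]) (simp only: g add_diff_cancel_left')
      moreover have "(q / sinh (r / 2)) *\<^sub>R (sinh (r / 2) *\<^sub>R u) = w"
        using q assms by (simp add: u_def)
      ultimately show ?thesis by simp
    qed (simp add: span_zero)
    then have "w - mink v (coords x) *\<^sub>R coords x \<in> span (coords ` ball x r)"
      using x by (intro span_diff span_scale)
    then show ?thesis by (simp add: w_def)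
  qed
  then show ?thesis by blast
qed

text \<open>Distances determine Lorentz products, so the linear map prescribed on a basis taken from
  \<open>S\<close> preserves the form. Nondegeneracy makes it injective, hence onto, and agreement
  with \<open>f\<close> on the rest of \<open>S\<close> can then be tested against vectors
  \<open>T w\<close>.\<close>

lemma isometry_linear_extension:
  fixes f :: "hyp3 \<Rightarrow> hyp3"
  assumes iso: "\<And>x y. x \<in> S \<Longrightarrow> y \<in> S \<Longrightarrow> dist (f x) (f y) = dist x y"
    and S: "span (coords ` S) = UNIV"
  obtains T where "linear T" "surj T" "\<And>v w. mink (T v) (T w) = mink v w"
    "\<And>x. x \<in> S \<Longrightarrow> T (coords x) = coords (f x)"
proof -
  obtain B where B: "B \<subseteq> coords ` S" "independent B" "coords ` S \<subseteq> span B"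
    using maximal_independent_subset by blast
  have spB: "span B = UNIV" using S B(3) by (metis span_minimal subspace_span top.extremum_uniqueI)
  obtain T where T: "linear T" "\<forall>v\<in>B. T v = coords (f (hyp3 v))"
    using linear_independent_extend[OF B(2), of "\<lambda>v. coords (f (hyp3 v))"] by blast
  have TB: "\<exists>x\<in>S. v = coords x \<and> T v = coords (f x)" if v: "v \<in> B" for v
  proof -
    obtain x where "x \<in> S" "v = coords x" using v B(1) by blast
    then show ?thesis using T(2) v by (auto simp: coords_inverse)
  qed
  have mB: "mink (T v) (T w) = mink v w" if "v \<in> B" "w \<in> B" for v w
    using TB[OF that(1)] TB[OF that(2)] iso by (metis cosh_dist neg_equal_iff_equal)
  have lin1: "linear (\<lambda>v. mink (T v) (T w))" "linear (\<lambda>v. mink (T w) (T v))" for w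
    using linear_compose[OF T(1) linear_mink(1)] linear_compose[OF T(1) linear_mink(2)] by (simp_all add: o_def)
  have m1: "mink (T v) (T w) = mink v w" if "w \<in> B" for v w
    by (rule linear_eq_on_span[OF lin1(1) linear_mink(1), of B]) (use mB that spB in auto)
  have m: "mink (T v) (T w) = mink v w" for v w
    by (rule linear_eq_on_span[OF lin1(2) linear_mink(2), of B]) (use m1 spB in auto)
  have "v = 0" if "T v = 0" for v
    by (rule mink_nondegenerate) (metis m mink_zero(1) that)
  then have "inj T" using T(1) by (simp add: linear_injective_0)
  then have surj: "surj T" using T(1) by (simp add: linear_injective_imp_surjective)
  have "T (coords x) = coords (f x)" if "x \<in> S" for x
  proof -
    have "mink (T (coords x) - coords (f x)) (T w) = 0" for w
    proof -
      have "mink (T (coords x)) (T w) = mink (coords (f x)) (T w)"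
      proof (rule linear_eq_on_span[OF lin1(2), of _ B])
        show "linear (\<lambda>v. mink (coords (f x)) (T v))"
          using linear_compose[OF T(1) linear_mink(2)] by (simp add: o_def)
        fix v assume "v \<in> B"
        then obtain y where y: "y \<in> S" "v = coords y" "T v = coords (f y)" using TB by blast
        then show "mink (T (coords x)) (T v) = mink (coords (f x)) (T v)"
          using iso[OF that y(1)] m by (metis cosh_dist neg_equal_iff_equal)
      qed (use spB in auto)
      then show ?thesis by (simp add: mink_diff)
    qed
    then have "mink (T (coords x) - coords (f x)) w = 0" for w using surj by (metis surjD)
    then have "T (coords x) - coords (f x) = 0" by (rule mink_nondegenerate)
    then show ?thesis by simp
  qed
  then show thesis using that T(1) surj m by blast
qed

text \<open>The image of a ball is symmetric about the image of its centre, so it would lie in the bounding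
  plane; but the linear extension of the isometry is onto.\<close>

lemma no_isometry_ball_to_half_space:
  fixes f :: "hyp3 \<Rightarrow> hyp3"
  assumes iso: "\<And>y z. y \<in> ball x r \<Longrightarrow> z \<in> ball x r \<Longrightarrow> dist (f y) (f z) = dist y z"
    and "r > 0" "n \<noteq> 0" and le: "\<And>y. y \<in> ball x r \<Longrightarrow> mink (coords (f y)) n \<le> 0"
    and bd: "mink (coords (f x)) n = 0"
  shows False
proof -
  obtain T where T: "linear T" "surj T" "\<And>v w. mink (T v) (T w) = mink v w"
    "\<And>y. y \<in> ball x r \<Longrightarrow> T (coords y) = coords (f y)"
    using isometry_linear_extension[OF iso span_coords_ball[OF \<open>r > 0\<close>]] by blast
  have Tx: "mink (T (coords x)) n = 0" using T(4) bd \<open>r > 0\<close> by simp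
  note lin = linear_add[OF T(1)] linear_cmul[OF T(1)]
  have le': "sinh (dist x y) * mink (T u) n = 0"
    if "y \<in> ball x r" and u: "mink u u = 1" "mink (coords x) u = 0" and
      "coords y = cosh (dist x y) *\<^sub>R coords x + sinh (dist x y) *\<^sub>R u" for y u
  proof -
    obtain \<gamma> where g: "\<And>s. coords (\<gamma> s) = cosh s *\<^sub>R coords x + sinh s *\<^sub>R u"
      "\<And>s t. dist (\<gamma> s) (\<gamma> t) = \<bar>s - t\<bar>" using coords_ray[OF u] by blast
    have "\<gamma> 0 = x" using g(1)[of 0] by (simp add: coords_inject)
    then have gb: "\<gamma> s \<in> ball x r" if "\<bar>s\<bar> < r" for s using that g(2)[of 0 s] by simp
    have "sinh s * mink (T u) n \<le> 0" if "\<bar>s\<bar> < r" for s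
    proof -
      have "coords (f (\<gamma> s)) = cosh s *\<^sub>R T (coords x) + sinh s *\<^sub>R T u"
        using T(4)[OF gb[OF that]] by (simp add: g lin)
      then show ?thesis using le[OF gb[OF that]] by (simp add: mink_bilinear Tx)
    qed
    \<comment> \<open>The points at \<open>s\<close> and \<open>- s\<close> both lie in the ball,
      and \<open>sinh\<close> is odd.\<close>
    from this[of "dist x y"] this[of "- dist x y"] show ?thesis using that(1) by auto
  qed
  have z: "mink (T (coords y)) n = 0" if y: "y \<in> ball x r" for y
  proof (cases "y = x")
    case False
    then obtain u where u: "mink u u = 1" "mink (coords x) u = 0"
      "coords y = cosh (dist x y) *\<^sub>R coords x + sinh (dist x y) *\<^sub>R u" using unit_tangent[of x y] by metis
    have "mink (T (coords y)) n = cosh (dist x y) * mink (T (coords x)) n + sinh (dist x y) * mink (T u) n"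
      by (subst u(3)) (simp add: lin mink_bilinear)
    then show ?thesis using le'[OF y u] Tx by simp
  qed (simp add: Tx)
  have lin0: "linear (\<lambda>v. mink (T v) n)"
    using linear_compose[OF T(1) linear_mink(1)] by (simp add: o_def)
  have "mink (T v) n = 0" for v
    by (rule linear_eq_0_on_span[OF lin0, of "coords ` ball x r"])
      (use z span_coords_ball[OF \<open>r > 0\<close>] in auto)
  then have "mink n w = 0" for w using T(2) by (metis mink_commute surjD)
  then show False using mink_nondegenerate \<open>n \<noteq> 0\<close> by blast
qed

section \<open>Normals and supporting planes\<close>

text \<open>A sign change in the time coordinate turns the Euclidean normal of the carrying subspace
  into a Lorentz normal; it is spacelike, hence can be normalised, because the plane contains a
  point.\<close>

lemma hyp_plane_normal:
  assumes "hyp_plane P"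
  obtains n where "mink n n = 1" "P = {x. mink (coords x) n = 0}"
proof -
  obtain W where W: "subspace W" "dim W = 3" "P = {x. coords x \<in> W}"
    using assms by (auto simp: hyp_plane_def)
  obtain x where x: "coords x \<in> W" using assms W(3) by (auto simp: hyp_plane_def)
  have "dim W = DIM(real \<times> (real^3)) - 1" using W(2) by simp
  then have "\<exists>a. a \<noteq> 0 \<and> span W = {v. a \<bullet> v = 0}" unfolding dim_eq_hyperplane .
  then obtain a where a: "a \<noteq> 0" "span W = {v. a \<bullet> v = 0}" by blast
  define n0 where "n0 = (- fst a, snd a)"
  have n0: "mink v n0 = a \<bullet> v" for v
    by (simp add: n0_def mink_def inner_prod_def inner_commute)
  have WW: "W = {v. mink v n0 = 0}" using a(2) span_eq_iff[of W] W(1) by (simp add: n0)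
  have "n0 \<noteq> 0" using a(1) by (auto simp: n0_def prod_eq_iff)
  then have pos: "mink n0 n0 > 0"
    using mink_orthogonal_pos[of n0 x] x by (simp add: WW mink_commute)
  define q where "q = sqrt (mink n0 n0)"
  have q: "q > 0" "mink n0 n0 = q * q" using pos by (simp_all add: q_def)
  show thesis
  proof (rule that)
    show "mink ((1 / q) *\<^sub>R n0) ((1 / q) *\<^sub>R n0) = 1" using q by (simp add: mink_scale)
    show "P = {x. mink (coords x) ((1 / q) *\<^sub>R n0) = 0}" using q by (simp add: W(3) WW mink_scale)
  qed
qed

text \<open>Near \<open>z\<close>, the points on the side of \<open>y\<close> lie on geodesics from \<open>y\<close> to the plane.\<close>

lemma convex_near_plane:
  assumes "geodesically_convex X" "{x. mink (coords x) n = 0} \<subseteq> X" "mink (coords z) n = 0" "y \<in> X"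
    "mink (coords y) n \<noteq> 0"
  obtains U where "open U" "z \<in> U" "\<And>q. q \<in> U \<Longrightarrow> mink (coords q) n / mink (coords y) n \<ge> 0 \<Longrightarrow> q \<in> X"
proof -
  define \<tau> where "\<tau> q = mink (coords q) n / mink (coords y) n" for q
  \<comment> \<open>Subtracting \<open>\<tau> q\<close> times \<open>coords y\<close> moves
    \<open>q\<close> into the hyperplane orthogonal to \<open>n\<close>. At \<open>z\<close> nothing
    is subtracted, so near \<open>z\<close> the result is still a positive multiple of a point
    \<open>a\<close> of the plane, and \<open>q\<close> lies between \<open>a\<close> and
    \<open>y\<close>.\<close>
  define w where "w q = coords q - \<tau> q *\<^sub>R coords y" for q
  have F: "mink (w q) (w q) = - 1 - 2 * \<tau> q * mink (coords q) (coords y) - \<tau> q * \<tau> q" for q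
    by (simp add: w_def mink_bilinear mink_coords_self mink_commute[of "coords y" "coords q"] algebra_simps)
  have G: "mink (w q) (coords z) = mink (coords q) (coords z) - \<tau> q * mink (coords y) (coords z)" for q
    by (simp add: w_def mink_bilinear)
  define U where "U = {q. mink (w q) (w q) < 0} \<inter> {q. mink (w q) (coords z) < 0}"
  have "open U"
    unfolding U_def F G \<tau>_def using assms(5)
    by (intro open_Int open_Collect_less continuous_intros) auto
  moreover have "z \<in> U"
    using assms(3) by (simp add: U_def F G \<tau>_def mink_coords_self)
  moreover have "q \<in> X" if q: "q \<in> U" "mink (coords q) n / mink (coords y) n \<ge> 0" for q
  proof -
    have neg: "mink (w q) (w q) < 0" "mink (w q) (coords z) < 0" using q by (auto simp: U_def)
    obtain a where a: "w q = sqrt (- mink (w q) (w q)) *\<^sub>R coords a"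
      using timelike_scaled_coords[OF neg] by blast
    define r where "r = sqrt (- mink (w q) (w q))"
    have r: "r > 0" "w q = r *\<^sub>R coords a" using neg(1) a by (simp_all add: r_def)
    have "mink (w q) n = 0" using assms(5) by (simp add: w_def \<tau>_def mink_bilinear)
    then have "mink (coords a) n = 0" using r by (simp add: mink_scale)
    then have a: "a \<in> X" using assms(2) by auto
    have eq: "coords q = r *\<^sub>R coords a + \<tau> q *\<^sub>R coords y" using r(2) by (simp add: w_def algebra_simps)
    show ?thesis
      by (rule geodesically_convex_conic[OF assms(1) a assms(4) _ _ eq]) (use r(1) q(2) in \<open>simp_all add: \<tau>_def\<close>)
  qed
  ultimately show thesis by (rule that)
qed

text \<open>If \<open>X\<close> had points on both sides, \<open>convex_near_plane\<close> would put
  both half-neighbourhoods of a point of \<open>P\<close> into \<open>X\<close> and make that point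
  interior.\<close>

lemma frontier_plane_supports:
  assumes "geodesically_convex X" "P \<subseteq> X" "hyp_plane P" "P \<inter> interior X = {}"
  obtains n where "mink n n = 1" "P = {x. mink (coords x) n = 0}" "\<And>x. x \<in> X \<Longrightarrow> mink (coords x) n \<le> 0"
proof -
  obtain n where n: "mink n n = 1" "P = {x. mink (coords x) n = 0}"
    using hyp_plane_normal[OF assms(3)] by blast
  obtain z where z: "z \<in> P" using assms(3) by (auto simp: hyp_plane_def)
  have "\<not> (mink (coords x) n > 0 \<and> mink (coords y) n < 0)" if x: "x \<in> X" and y: "y \<in> X" for x y
  proof
    assume xy: "mink (coords x) n > 0 \<and> mink (coords y) n < 0"
    obtain U where U: "open U" "z \<in> U" "\<And>q. q \<in> U \<Longrightarrow> mink (coords q) n / mink (coords x) n \<ge> 0 \<Longrightarrow> q \<in> X"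
      using convex_near_plane[OF assms(1) assms(2)[unfolded n(2)] _ x, of z] z n(2) xy by auto
    obtain V where V: "open V" "z \<in> V" "\<And>q. q \<in> V \<Longrightarrow> mink (coords q) n / mink (coords y) n \<ge> 0 \<Longrightarrow> q \<in> X"
      using convex_near_plane[OF assms(1) assms(2)[unfolded n(2)] _ y, of z] z n(2) xy by auto
    have "q \<in> X" if "q \<in> U \<inter> V" for q
      using U(3)[of q] V(3)[of q] that xy
      by (cases "mink (coords q) n \<ge> 0") (auto simp: zero_le_divide_iff)
    then have "z \<in> interior X" using U V by (intro interiorI[of "U \<inter> V"]) auto
    then show False using z assms(4) by blast
  qed
  then consider "\<forall>x\<in>X. mink (coords x) n \<le> 0" | "\<forall>x\<in>X. mink (coords x) (- n) \<le> 0"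
    by (simp add: mink_minus) (metis linorder_not_less)
  then show thesis
  proof cases
    case 1
    then show ?thesis using that n by blast
  next
    case 2
    then show ?thesis using that[of "- n"] n by (auto simp: mink_minus)
  qed
qed

section \<open>Ultraparallel planes and their common perpendicular\<close>

text \<open>With \<open>h\<close> the hyperbolic sine of the distance from \<open>b\<close> to the
  plane of \<open>m\<close>, \<open>cosh (dist a b)\<close> is at least
  \<open>sqrt (1 + h * h)\<close>, and \<open>h = r * cosh (dist b b0)\<close> with
  \<open>r * r = k * k - 1\<close>. Hence the bound \<open>k\<close>, attained only at
  \<open>b = b0\<close>; exchanging the planes settles \<open>a\<close>.\<close>

lemma mink_perpendicular_bound:
  assumes mn: "mink m m = 1" "mink n n = 1" "mink m n = - k" "k > 1"
    and ab: "mink (coords a) m = 0" "mink (coords b) n = 0"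
    and b0: "sqrt (k\<^sup>2 - 1) *\<^sub>R coords b0 = m + k *\<^sub>R n"
  shows "mink (coords a) (coords b) \<le> - k" "mink (coords a) (coords b) = - k \<Longrightarrow> b = b0"
proof -
  define r where "r = sqrt (k\<^sup>2 - 1)"
  have "k\<^sup>2 > 1" using mn(4) by simp
  then have r: "r > 0" "r * r = k * k - 1" by (simp_all add: r_def power2_eq_square)
  define h where "h = - mink (coords b) m"
  have "r * mink (coords b) (coords b0) = mink (coords b) (r *\<^sub>R coords b0)" by (simp add: mink_scale)
  also have "\<dots> = - h" by (simp add: r_def b0 mink_bilinear ab h_def)
  finally have hb: "h = r * (- mink (coords b) (coords b0))" by simp
  then have hr: "h \<ge> r" using r(1) mult_left_mono[of 1 "- mink (coords b) (coords b0)" r] mink_coords_le[of b b0] by simp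
  \<comment> \<open>A multiple of the foot \<open>c\<close> of the perpendicular from
    \<open>b\<close> to the plane of \<open>m\<close>.\<close>
  define v where "v = coords b + h *\<^sub>R m"
  have vv: "mink v v = - (1 + h * h)"
    by (simp add: v_def mink_bilinear mink_coords_self mn mink_commute[of m "coords b"] h_def)
  have vb: "mink v (coords b) = - (1 + h * h)"
    by (simp add: v_def mink_bilinear mink_coords_self mink_commute[of m "coords b"] h_def)
  have pos: "1 + h * h > 0" by (simp add: add_pos_nonneg)
  obtain c where c: "v = sqrt (1 + h * h) *\<^sub>R coords c"
    using timelike_scaled_coords[of v b] vv vb pos by (metis add.inverse_inverse neg_less_0_iff_less)
  have "mink (coords a) (coords b) = mink (coords a) v"
    by (simp add: v_def mink_bilinear ab)
  also have "\<dots> = sqrt (1 + h * h) * mink (coords a) (coords c)" by (simp add: c mink_scale)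
  also have "\<dots> \<le> - sqrt (1 + h * h)"
    using mult_left_mono[OF mink_coords_le[of a c], of "sqrt (1 + h * h)"] pos by simp
  finally have 1: "mink (coords a) (coords b) \<le> - sqrt (1 + h * h)" .
  have "k * k \<le> 1 + h * h" using mult_mono[OF hr hr] hr r by simp
  then have 2: "k \<le> sqrt (1 + h * h)" by (simp add: real_le_rsqrt power2_eq_square)
  show "mink (coords a) (coords b) \<le> - k" using 1 2 by simp
  assume "mink (coords a) (coords b) = - k"
  then have "sqrt (1 + h * h) = k" using 1 2 by simp
  then have "h * h = r * r" using r(2) pos by (metis add_diff_cancel_left' less_imp_le real_sqrt_mult_self abs_of_pos)
  then have "h = r" using hr r(1) by (metis abs_of_pos less_le_trans real_sqrt_abs2)
  then have "r * mink (coords b) (coords b0) = r * - 1" using hb by simp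
  then have "mink (coords b) (coords b0) = - 1" using r(1) by (metis less_irrefl mult_left_cancel)
  then have "cosh (dist b b0) = 1" by (simp add: cosh_dist)
  then show "b = b0" by (metis cosh_real_one_iff dist_eq_0_iff)
qed

text \<open>Disjointness alone would allow asymptotic planes. The uniform gap excludes them: it
  bounds \<open>- mink (coords a) n\<close> away from zero on the plane of \<open>m\<close>, which
  fails along a ray towards \<open>w\<close>, the part of \<open>n\<close> orthogonal to
  \<open>m\<close>, unless \<open>w\<close> is timelike.\<close>

lemma ultraparallel_normals:
  assumes mn: "mink m m = 1" "mink n n = 1"
    and A: "\<And>a. mink (coords a) m = 0 \<Longrightarrow> mink (coords a) n \<le> 0" "mink (coords a0) m = 0"
    and gap: "\<epsilon> > 0" "\<And>a b. mink (coords a) m = 0 \<Longrightarrow> mink (coords b) n = 0 \<Longrightarrow> dist a b \<ge> \<epsilon>"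
  obtains a where "(mink m n)\<^sup>2 > 1" "sqrt ((mink m n)\<^sup>2 - 1) *\<^sub>R coords a = n - mink m n *\<^sub>R m"
proof -
  define j where "j = mink m n"
  define w where "w = n - j *\<^sub>R m"
  have wm: "mink w m = 0" "mink m w = 0" by (simp_all add: w_def mink_bilinear mn j_def mink_commute[of n m])
  have ww: "mink w w = 1 - j * j" by (simp add: w_def mink_bilinear mn j_def mink_commute[of n m])
  \<comment> \<open>The foot \<open>b\<close> of the perpendicular from \<open>a\<close> to the
    other plane satisfies \<open>cosh (dist a b) = sqrt (1 + h * h)\<close>; this turns the gap in
    distance into a gap in the product.\<close>
  have away: "sinh \<epsilon> \<le> - mink (coords a) n" if a: "mink (coords a) m = 0" for a
  proof -
    define h where "h = - mink (coords a) n"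
    have h0: "h \<ge> 0" using A(1)[OF a] by (simp add: h_def)
    define v where "v = coords a + h *\<^sub>R n"
    have pos: "1 + h * h > 0" by (simp add: add_pos_nonneg)
    have vv: "mink v v = - (1 + h * h)"
      by (simp add: v_def mink_bilinear mink_coords_self mn mink_commute[of n "coords a"] h_def)
    have va: "mink v (coords a) = - (1 + h * h)"
      by (simp add: v_def mink_bilinear mink_coords_self mink_commute[of n "coords a"] h_def)
    obtain b where b: "v = sqrt (1 + h * h) *\<^sub>R coords b"
      using timelike_scaled_coords[of v a] vv va pos by (metis add.inverse_inverse neg_less_0_iff_less)
    have "mink v n = 0" by (simp add: v_def mink_bilinear mn h_def)
    then have "mink (coords b) n = 0" using pos by (simp add: b mink_scale)
    then have "dist a b \<ge> \<epsilon>" using gap a by simp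
    then have "cosh \<epsilon> \<le> cosh (dist a b)" using gap(1) by (simp add: cosh_real_nonneg_le_iff)
    moreover have "sqrt (1 + h * h) * cosh (dist a b) = sqrt (1 + h * h) * sqrt (1 + h * h)"
    proof -
      have "sqrt (1 + h * h) * cosh (dist a b) = - mink v (coords a)"
        by (simp add: b mink_scale cosh_dist mink_commute)
      then show ?thesis using va pos by simp
    qed
    ultimately have "cosh \<epsilon> \<le> sqrt (1 + h * h)"
      using pos by (metis less_irrefl mult_left_cancel real_sqrt_gt_zero)
    then have "(cosh \<epsilon>)\<^sup>2 \<le> (sqrt (1 + h * h))\<^sup>2" by (intro power_mono) auto
    then have "(sinh \<epsilon>)\<^sup>2 \<le> h\<^sup>2" using pos by (simp add: cosh_square_eq) (simp add: power2_eq_square)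
    then have "sinh \<epsilon> \<le> h" using h0 by (rule power2_le_imp_le)
    then show ?thesis by (simp add: h_def)
  qed
  define t where "t = - mink (coords a0) n"
  have sp: "sinh \<epsilon> > 0" using gap(1) by simp
  have t: "t > 0" "sinh \<epsilon> \<le> t" using away[OF A(2)] sp unfolding t_def by linarith+
  have wa: "mink w (coords a0) = - t" "mink (coords a0) w = - t"
    by (simp_all add: w_def mink_bilinear t_def A(2) mink_commute[of _ "coords a0"])
  \<comment> \<open>Otherwise the planes meet or are asymptotic: a ray from \<open>a0\<close> in the first plane comes
    arbitrarily close to the second.\<close>
  have neg: "mink w w < 0"
  proof (rule ccontr)
    assume "\<not> mink w w < 0"
    \<comment> \<open>The part of \<open>w\<close> orthogonal to \<open>a0\<close>. Its length
      \<open>q\<close> is at least \<open>t\<close> because \<open>w\<close> is not timelike, so for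
      \<open>s \<ge> 0\<close> the ray has \<open>- mink (coords (\<gamma> s)) n\<close> at most
      \<open>t * exp (- s)\<close>.\<close>
    define u where "u = w - t *\<^sub>R coords a0"
    define q where "q = sqrt (mink u u)"
    have uu: "mink u u = mink w w + t * t" by (simp add: u_def mink_bilinear wa mink_coords_self)
    then have "mink u u \<ge> t * t" using \<open>\<not> mink w w < 0\<close> by simp
    then have qt: "q \<ge> t" using t by (simp add: q_def real_le_rsqrt power2_eq_square)
    have q: "q > 0" using qt t by linarith
    then have qq: "q * q = mink u u" by (simp add: q_def)
    define e where "e = (1 / q) *\<^sub>R u"
    have e: "mink e e = 1" "mink (coords a0) e = 0" "mink e m = 0"
      using q by (simp_all add: e_def mink_scale flip: qq) (simp_all add: u_def mink_bilinear wa mink_coords_self wm A(2))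
    have ew: "mink e w = q"
    proof -
      have "mink e w = mink e (u + t *\<^sub>R coords a0)" by (simp add: u_def)
      also have "\<dots> = mink e u" using e(2) by (simp add: mink_bilinear mink_commute)
      also have "\<dots> = (1 / q) * (q * q)" by (simp add: e_def mink_scale qq)
      finally show ?thesis using q by simp
    qed
    obtain \<gamma> where g: "\<And>s. coords (\<gamma> s) = cosh s *\<^sub>R coords a0 + sinh s *\<^sub>R e"
      "\<And>s t. dist (\<gamma> s) (\<gamma> t) = \<bar>s - t\<bar>" using coords_ray[OF e(1,2)] by blast
    have gm: "mink (coords (\<gamma> s)) m = 0" for s by (simp add: g mink_bilinear A(2) e(3))
    have gn: "mink (coords (\<gamma> s)) n = - t * cosh s + q * sinh s" for s
    proof -
      have "mink (coords (\<gamma> s)) n = mink (coords (\<gamma> s)) (w + j *\<^sub>R m)" by (simp add: w_def)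
      also have "\<dots> = mink (coords (\<gamma> s)) w" by (simp add: mink_bilinear gm)
      also have "\<dots> = - t * cosh s + q * sinh s" by (simp add: g mink_bilinear wa ew)
      finally show ?thesis .
    qed
    \<comment> \<open>Chosen so that \<open>t * exp (- s)\<close> is half of the lower bound
      \<open>sinh \<epsilon>\<close>.\<close>
    define s where "s = - ln (sinh \<epsilon> / (2 * t))"
    have "sinh \<epsilon> / (2 * t) > 0" by (rule divide_pos_pos[OF sp]) (use t(1) in simp)
    moreover have "sinh \<epsilon> / (2 * t) \<le> 1" using t by (simp only: divide_le_eq_1) argo
    ultimately have s0: "s \<ge> 0" by (simp add: s_def)
    have "sinh \<epsilon> \<le> t * cosh s - q * sinh s" using away[OF gm[of s]] by (simp add: gn)
    also have "\<dots> \<le> t * cosh s - t * sinh s" using qt s0 by (simp add: mult_right_mono)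
    also have "\<dots> = t * (cosh s - sinh s)" by (simp add: algebra_simps)
    also have "\<dots> = t * exp (- s)" by (simp add: cosh_minus_sinh)
    also have "\<dots> = t * (sinh \<epsilon> / (2 * t))" using \<open>sinh \<epsilon> / (2 * t) > 0\<close> by (simp only: s_def minus_minus exp_ln)
    also have "\<dots> = sinh \<epsilon> / 2" using t(1) by simp
    finally show False using sp by simp
  qed
  have s: "- mink w w = (mink m n)\<^sup>2 - 1" by (simp add: ww j_def power2_eq_square)
  obtain a where "w = sqrt (- mink w w) *\<^sub>R coords a"
    using timelike_scaled_coords[OF neg, of a0] wa t by auto
  then have "sqrt ((mink m n)\<^sup>2 - 1) *\<^sub>R coords a = n - mink m n *\<^sub>R m"
    by (simp add: s[symmetric]) (simp add: w_def j_def)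
  moreover have "(mink m n)\<^sup>2 > 1" using neg s by simp
  ultimately show thesis by (rule that[rotated])
qed

text \<open>\<open>ultraparallel_normals\<close> yields only \<open>k\<^sup>2 > 1\<close>. The sign
  of \<open>k\<close> comes from the feet: both are points and their product is \<open>- k\<close>,
  which is therefore at most -1.\<close>

lemma common_perpendicular:
  assumes mn: "mink m m = 1" "mink n n = 1"
    and A: "\<And>a. mink (coords a) m = 0 \<Longrightarrow> mink (coords a) n \<le> 0" "mink (coords a') m = 0"
    and B: "\<And>b. mink (coords b) n = 0 \<Longrightarrow> mink (coords b) m \<le> 0" "mink (coords b') n = 0"
    and gap: "\<epsilon> > 0" "\<And>a b. mink (coords a) m = 0 \<Longrightarrow> mink (coords b) n = 0 \<Longrightarrow> dist a b \<ge> \<epsilon>"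
  obtains k r a0 b0 where "k > 1" "r > 0" "mink m n = - k"
    "coords a0 = r *\<^sub>R (n + k *\<^sub>R m)" "coords b0 = r *\<^sub>R (m + k *\<^sub>R n)"
    "mink (coords a0) m = 0" "mink (coords b0) n = 0" "cosh (dist a0 b0) = k"
    "\<And>a b. mink (coords a) m = 0 \<Longrightarrow> mink (coords b) n = 0 \<Longrightarrow>
      dist a0 b0 \<le> dist a b \<and> (dist a b = dist a0 b0 \<longrightarrow> a = a0 \<and> b = b0)"
proof -
  define k where "k = - mink m n"
  obtain a0 where a0: "(mink m n)\<^sup>2 > 1" "sqrt ((mink m n)\<^sup>2 - 1) *\<^sub>R coords a0 = n - mink m n *\<^sub>R m"
    using ultraparallel_normals[OF mn A gap] by blast
  obtain b0 where b0: "(mink n m)\<^sup>2 > 1" "sqrt ((mink n m)\<^sup>2 - 1) *\<^sub>R coords b0 = m - mink n m *\<^sub>R n"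
    using ultraparallel_normals[OF mn(2,1) B gap(1)] gap(2) by (metis dist_commute)
  define s where "s = sqrt (k\<^sup>2 - 1)"
  have "k\<^sup>2 > 1" using a0(1) by (simp add: k_def)
  then have s: "s > 0" "s * s = k * k - 1" by (simp_all add: s_def power2_eq_square)
  have A0: "s *\<^sub>R coords a0 = n + k *\<^sub>R m" using a0(2) by (simp add: s_def k_def)
  have B0: "s *\<^sub>R coords b0 = m + k *\<^sub>R n" using b0(2) by (simp add: s_def k_def mink_commute[of n m])
  have mk: "mink m n = - k" "mink n m = - k" by (simp_all add: k_def mink_commute)
  have "s * s * mink (coords a0) (coords b0) = mink (s *\<^sub>R coords a0) (s *\<^sub>R coords b0)" by (simp add: mink_scale)
  also have "\<dots> = s * s * (- k)" by (simp add: A0 B0 mink_bilinear mn mk s(2) algebra_simps)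
  finally have "(s * s) * mink (coords a0) (coords b0) = (s * s) * (- k)" .
  then have ab: "mink (coords a0) (coords b0) = - k" using s(1) by (metis mult_left_cancel mult_pos_pos less_irrefl)
  then have k1: "k \<ge> 1" using mink_coords_le[of a0 b0] by simp
  then have k: "k > 1" using \<open>k\<^sup>2 > 1\<close> by (cases "k = 1") auto
  have "s * mink (coords a0) m = mink (s *\<^sub>R coords a0) m" "s * mink (coords b0) n = mink (s *\<^sub>R coords b0) n"
    by (simp_all add: mink_scale)
  then have perp: "mink (coords a0) m = 0" "mink (coords b0) n = 0"
    using s(1) by (simp_all add: A0 B0 mink_bilinear mn mk)
  have d: "cosh (dist a0 b0) = k" by (simp add: cosh_dist ab)
  have fin: "dist a0 b0 \<le> dist a b \<and> (dist a b = dist a0 b0 \<longrightarrow> a = a0 \<and> b = b0)"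
    if "mink (coords a) m = 0" "mink (coords b) n = 0" for a b
  proof -
    note 1 = mink_perpendicular_bound[OF mn mk(1) k that B0[unfolded s_def]]
    note 2 = mink_perpendicular_bound[OF mn(2,1) mk(2) k that(2,1) A0[unfolded s_def]]
    have "cosh (dist a0 b0) \<le> cosh (dist a b)" using 1(1) by (simp add: d) (simp add: cosh_dist)
    then have "dist a0 b0 \<le> dist a b" by (simp add: cosh_real_nonneg_le_iff)
    moreover have "a = a0 \<and> b = b0" if "dist a b = dist a0 b0"
    proof -
      have "mink (coords a) (coords b) = - k" using that d cosh_dist[of a b] by simp
      then show ?thesis using 1(2) 2(2) by (simp add: mink_commute)
    qed
    ultimately show ?thesis by blast
  qed
  show thesis
  proof (rule that[of k "1 / s" a0 b0])
    show "coords a0 = (1 / s) *\<^sub>R (n + k *\<^sub>R m)" "coords b0 = (1 / s) *\<^sub>R (m + k *\<^sub>R n)"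
      using s(1) by (simp_all flip: A0 B0)
  qed (use k s mk perp d fin in auto)
qed

section \<open>Conic combinations of equidistant normals\<close>

lemma mink_sum_sum:
  "mink (\<Sum>i\<in>I. a i *\<^sub>R \<nu> i) (\<Sum>j\<in>J. b j *\<^sub>R \<nu> j) = (\<Sum>i\<in>I. \<Sum>j\<in>J. a i * b j * mink (\<nu> i) (\<nu> j))"
  unfolding mink_sum(1) mink_sum(2) mink_scale
  by (subst sum.swap) (simp add: sum_distrib_left mult.assoc mult.left_commute)

text \<open>The Gram matrix is \<open>1 + c\<close> times the identity minus \<open>c\<close> times
  the all-ones matrix.\<close>

lemma mink_equidistant_sum:
  assumes "finite I" and eq: "\<And>i j. i \<in> I \<Longrightarrow> j \<in> I \<Longrightarrow> mink (\<nu> i) (\<nu> j) = (if i = j then 1 else - c)"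
  shows "mink (\<Sum>i\<in>I. a i *\<^sub>R \<nu> i) (\<Sum>i\<in>I. a i *\<^sub>R \<nu> i) = (1 + c) * (\<Sum>i\<in>I. (a i)\<^sup>2) - c * (\<Sum>i\<in>I. a i)\<^sup>2"
proof -
  have "mink (\<Sum>i\<in>I. a i *\<^sub>R \<nu> i) (\<Sum>i\<in>I. a i *\<^sub>R \<nu> i) =
      (\<Sum>i\<in>I. \<Sum>j\<in>I. (if i = j then (1 + c) * (a i * a j) else 0) - c * (a i * a j))"
    unfolding mink_sum_sum by (intro sum.cong refl) (auto simp: eq algebra_simps)
  also have "\<dots> = (\<Sum>i\<in>I. (1 + c) * (a i)\<^sup>2) - c * (\<Sum>i\<in>I. \<Sum>j\<in>I. a i * a j)"
    using assms(1) by (simp add: sum_subtractf sum.delta' sum_distrib_left power2_eq_square)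
  also have "(\<Sum>i\<in>I. \<Sum>j\<in>I. a i * a j) = (\<Sum>i\<in>I. a i)\<^sup>2"
    by (simp add: sum_product power2_eq_square)
  finally show ?thesis by (simp add: sum_distrib_left)
qed

lemma equidistant_normals_disjoint:
  fixes \<nu> :: "'i \<Rightarrow> real \<times> (real^3)" and c :: real
  assumes fin: "finite I" "finite J" and ne: "I \<noteq> {}" "J \<noteq> {}" and c: "c > 0"
    and I: "\<And>i j. i \<in> I \<Longrightarrow> j \<in> I \<Longrightarrow> mink (\<nu> i) (\<nu> j) = (if i = j then 1 else - c)"
    and J: "\<And>i j. i \<in> J \<Longrightarrow> j \<in> J \<Longrightarrow> mink (\<nu> i) (\<nu> j) = (if i = j then 1 else - c)"
    and IJ: "\<And>i j. i \<in> I \<Longrightarrow> j \<in> J \<Longrightarrow> mink (\<nu> i) (\<nu> j) \<le> - c"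
    and pos: "\<And>i. i \<in> I \<Longrightarrow> a i > 0" "\<And>j. j \<in> J \<Longrightarrow> b j > 0"
  shows "(\<Sum>i\<in>I. a i *\<^sub>R \<nu> i) \<noteq> (\<Sum>j\<in>J. b j *\<^sub>R \<nu> j)"
proof
  assume eq: "(\<Sum>i\<in>I. a i *\<^sub>R \<nu> i) = (\<Sum>j\<in>J. b j *\<^sub>R \<nu> j)"
  define Y where "Y = mink (\<Sum>i\<in>I. a i *\<^sub>R \<nu> i) (\<Sum>i\<in>I. a i *\<^sub>R \<nu> i)"
  define S where "S = (\<Sum>i\<in>I. a i)"
  define T where "T = (\<Sum>j\<in>J. b j)"
  have ST: "S > 0" "T > 0" unfolding S_def T_def using fin ne pos by (auto intro: sum_pos)
  have "Y = (\<Sum>i\<in>I. \<Sum>j\<in>J. a i * b j * mink (\<nu> i) (\<nu> j))"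
    unfolding Y_def by (subst (2) eq) (rule mink_sum_sum)
  also have "\<dots> \<le> (\<Sum>i\<in>I. \<Sum>j\<in>J. a i * b j * (- c))"
    using IJ pos by (intro sum_mono mult_left_mono mult_nonneg_nonneg) (simp_all add: less_imp_le)
  also have "\<dots> = - (c * (\<Sum>i\<in>I. \<Sum>j\<in>J. a i * b j))"
    by (simp add: sum_distrib_left sum_negf algebra_simps)
  also have "(\<Sum>i\<in>I. \<Sum>j\<in>J. a i * b j) = S * T" by (simp add: S_def T_def sum_product)
  finally have 0: "Y \<le> - (c * (S * T))" .
  have 1: "Y > - (c * S\<^sup>2)"
  proof -
    have "(\<Sum>i\<in>I. (a i)\<^sup>2) > 0" using fin ne pos(1) by (intro sum_pos zero_less_power) auto
    then show ?thesis
      using mink_equidistant_sum[OF fin(1) I, where a=a] c by (simp add: Y_def S_def)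
  qed
  have 2: "Y > - (c * T\<^sup>2)"
  proof -
    have "(\<Sum>i\<in>J. (b i)\<^sup>2) > 0" using fin ne pos(2) by (intro sum_pos zero_less_power) auto
    then show ?thesis
      using mink_equidistant_sum[OF fin(2) J, where a=b] c by (simp add: Y_def T_def eq)
  qed
  \<comment> \<open>The first inequality amounts to \<open>T < S\<close>, the second to
    \<open>S < T\<close>.\<close>
  have "c * (S * T) < c * (S * S)" "c * (S * T) < c * (T * T)"
    using 0 1 2 by (simp_all add: power2_eq_square)
  then have "S * T < S * S" "S * T < T * T" using c by simp_all
  then show False using ST by simp
qed

text \<open>\<open>d\<close> holds the coefficients left after cancellation: its positive part is
  supported in \<open>I\<close>, its negative part in \<open>J\<close>, and an element of
  \<open>J\<close> outside \<open>I\<close> keeps the latter nonempty. The cardinalities serve the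
  case of an empty positive part, where they supply a normal outside \<open>J\<close> to pair
  with.\<close>

lemma equidistant_normals_subset:
  fixes \<nu> :: "'i \<Rightarrow> real \<times> (real^3)" and c :: real
  assumes fin: "finite I" "finite J" and "card J < card I" and c: "c > 0"
    and I: "\<And>i j. i \<in> I \<Longrightarrow> j \<in> I \<Longrightarrow> mink (\<nu> i) (\<nu> j) = (if i = j then 1 else - c)"
    and J: "\<And>i j. i \<in> J \<Longrightarrow> j \<in> J \<Longrightarrow> mink (\<nu> i) (\<nu> j) = (if i = j then 1 else - c)"
    and IJ: "\<And>i j. i \<in> I \<Longrightarrow> j \<in> J \<Longrightarrow> i \<noteq> j \<Longrightarrow> mink (\<nu> i) (\<nu> j) \<le> - c"
    and pos: "\<And>i. i \<in> I \<Longrightarrow> a i \<ge> 0" "\<And>j. j \<in> J \<Longrightarrow> b j > 0"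
    and eq: "(\<Sum>i\<in>I. a i *\<^sub>R \<nu> i) = (\<Sum>j\<in>J. b j *\<^sub>R \<nu> j)"
  shows "J \<subseteq> I"
proof (rule ccontr)
  assume "\<not> J \<subseteq> I"
  then obtain j0 where j0: "j0 \<in> J" "j0 \<notin> I" by blast
  have "\<not> I \<subseteq> J" using fin assms(3) by (meson card_mono leD)
  then obtain i0 where i0: "i0 \<in> I" "i0 \<notin> J" by blast
  define d where "d i = (if i \<in> I then a i else 0) - (if i \<in> J then b i else 0)" for i
  define I' where "I' = {i \<in> I \<union> J. d i > 0}"
  define J' where "J' = {i \<in> I \<union> J. d i < 0}"
  have sub: "I' \<subseteq> I" "J' \<subseteq> J" "I' \<inter> J' = {}"
    using pos by (force simp: I'_def J'_def d_def split: if_splits)+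
  have fin': "finite I'" "finite J'" using fin sub by (auto intro: finite_subset)
  have J'ne: "j0 \<in> J'" using j0 pos by (simp add: J'_def d_def)
  have a: "(\<Sum>i\<in>I \<union> J. (if i \<in> I then a i else 0) *\<^sub>R \<nu> i) = (\<Sum>i\<in>I. a i *\<^sub>R \<nu> i)"
    using fin by (intro sum.mono_neutral_cong_right) auto
  have b: "(\<Sum>i\<in>I \<union> J. (if i \<in> J then b i else 0) *\<^sub>R \<nu> i) = (\<Sum>i\<in>J. b i *\<^sub>R \<nu> i)"
    using fin by (intro sum.mono_neutral_cong_right) auto
  have "(\<Sum>i\<in>I \<union> J. d i *\<^sub>R \<nu> i) = 0"
    by (simp add: d_def scaleR_diff_left sum_subtractf a b eq)
  moreover have "(\<Sum>i\<in>I \<union> J. d i *\<^sub>R \<nu> i) = (\<Sum>i\<in>I' \<union> J'. d i *\<^sub>R \<nu> i)"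
    using fin by (intro sum.mono_neutral_right) (auto simp: I'_def J'_def)
  moreover have "\<dots> = (\<Sum>i\<in>I'. d i *\<^sub>R \<nu> i) + (\<Sum>i\<in>J'. d i *\<^sub>R \<nu> i)"
    using fin' sub by (intro sum.union_disjoint) auto
  ultimately have eq': "(\<Sum>i\<in>I'. d i *\<^sub>R \<nu> i) = (\<Sum>i\<in>J'. (- d i) *\<^sub>R \<nu> i)"
    by (simp add: sum_negf eq_neg_iff_add_eq_0)
  show False
  proof (cases "I' = {}")
    case False
    have "(\<Sum>i\<in>I'. d i *\<^sub>R \<nu> i) \<noteq> (\<Sum>i\<in>J'. (- d i) *\<^sub>R \<nu> i)"
    proof (rule equidistant_normals_disjoint[OF fin' False _ c])
      fix i j assume "i \<in> I'" "j \<in> J'"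
      then show "mink (\<nu> i) (\<nu> j) \<le> - c" using sub by (intro IJ) auto
    qed (use J'ne I J sub in \<open>auto simp: subset_iff I'_def J'_def\<close>)
    then show False using eq' by simp
  next
    case True
    then have "(\<Sum>i\<in>J'. (- d i) *\<^sub>R \<nu> i) = 0" using eq' by simp
    \<comment> \<open>All terms of this product are strictly negative, since \<open>i0\<close> is
      not in \<open>J\<close>.\<close>
    then have "mink (\<nu> i0) (\<Sum>i\<in>J'. (- d i) *\<^sub>R \<nu> i) = 0" by (simp add: mink_zero)
    then have "(\<Sum>i\<in>J'. (- d i) * mink (\<nu> i0) (\<nu> i)) = 0" by (simp add: mink_sum mink_scale mink_minus)
    moreover have "(\<Sum>i\<in>J'. (- d i) * mink (\<nu> i0) (\<nu> i)) < (\<Sum>i\<in>J'. 0)"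
    proof (rule sum_strict_mono)
      fix i assume i: "i \<in> J'"
      then have "i \<in> J" "i0 \<noteq> i" "d i < 0" using sub i0 by (auto simp: J'_def)
      then have "mink (\<nu> i0) (\<nu> i) < 0" using IJ[OF i0(1)] c by force
      then show "(- d i) * mink (\<nu> i0) (\<nu> i) < 0" using \<open>d i < 0\<close> by (simp add: mult_neg_neg)
    qed (use fin' J'ne in auto)
    ultimately show False by simp
  qed
qed

text \<open>Pairing the relation with each \<open>\<nu> j\<close> shows that every coefficient is
  the same multiple of the sum \<open>S\<close>. Adding these equations forces \<open>S = 0\<close>
  unless \<open>c * card I = 1 + c\<close>, the value at which the Gram matrix is singular.\<close>

lemma equidistant_normals_independent:
  fixes \<nu> :: "'i \<Rightarrow> real \<times> (real^3)" and c :: real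
  assumes fin: "finite I" and c: "c > 0" "c * card I \<noteq> 1 + c"
    and I: "\<And>i j. i \<in> I \<Longrightarrow> j \<in> I \<Longrightarrow> mink (\<nu> i) (\<nu> j) = (if i = j then 1 else - c)"
    and eq: "(\<Sum>i\<in>I. u i *\<^sub>R \<nu> i) = 0" and i: "i \<in> I"
  shows "u i = 0"
proof -
  define S where "S = (\<Sum>i\<in>I. u i)"
  have *: "(1 + c) * u j = c * S" if "j \<in> I" for j
  proof -
    have "0 = (\<Sum>i\<in>I. u i * mink (\<nu> i) (\<nu> j))"
      using arg_cong[OF eq, of "\<lambda>v. mink v (\<nu> j)"] by (simp add: mink_sum mink_scale mink_zero)
    also have "\<dots> = (\<Sum>i\<in>I. (if i = j then (1 + c) * u i else 0) - c * u i)"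
      using I that by (intro sum.cong refl) (auto simp: algebra_simps)
    also have "\<dots> = (1 + c) * u j - c * S"
      using fin that by (simp add: sum_subtractf S_def sum_distrib_left)
    finally show ?thesis by simp
  qed
  have "(1 + c) * S = (\<Sum>j\<in>I. (1 + c) * u j)" by (simp add: S_def sum_distrib_left)
  also have "\<dots> = card I * (c * S)" using * by simp
  finally have "(c * card I - (1 + c)) * S = 0" by (simp add: algebra_simps)
  then have "S = 0" using c by simp
  then show ?thesis using *[OF i] c by simp
qed

section \<open>The cone of normals and the filled region\<close>

text \<open>For the three walls of a hexagon this is, projectively, the part inside hyperbolic space
  of the triangle whose vertices are the poles of the walls. The hexagon is that triangle truncated
  by the walls.\<close>

definition conic_comb :: "'i set \<Rightarrow> ('i \<Rightarrow> real \<times> (real^3)) \<Rightarrow> hyp3 \<Rightarrow> bool" where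
  "conic_comb I \<nu> x \<longleftrightarrow> (\<exists>a. (\<forall>i\<in>I. a i \<ge> 0) \<and> coords x = (\<Sum>i\<in>I. a i *\<^sub>R \<nu> i))"

lemma conic_comb_geodesic:
  fixes g :: "real \<Rightarrow> hyp3"
  assumes "geodesic_path g" "conic_comb I \<nu> (pathstart g)" "conic_comb I \<nu> (pathfinish g)" "x \<in> path_image g"
  shows "conic_comb I \<nu> x"
proof -
  obtain a b where ab: "a \<ge> 0" "b \<ge> 0" "coords x = a *\<^sub>R coords (pathstart g) + b *\<^sub>R coords (pathfinish g)"
    using geodesic_path_conic[OF assms(1,4)] by blast
  obtain u where u: "\<forall>i\<in>I. u i \<ge> 0" "coords (pathstart g) = (\<Sum>i\<in>I. u i *\<^sub>R \<nu> i)"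
    using assms(2) by (auto simp: conic_comb_def)
  obtain v where v: "\<forall>i\<in>I. v i \<ge> 0" "coords (pathfinish g) = (\<Sum>i\<in>I. v i *\<^sub>R \<nu> i)"
    using assms(3) by (auto simp: conic_comb_def)
  have "coords x = (\<Sum>i\<in>I. (a * u i + b * v i) *\<^sub>R \<nu> i)"
    by (simp add: ab(3) u(2) v(2) scaleR_sum_right scaleR_add_left sum.distrib)
  then show ?thesis
    unfolding conic_comb_def using ab u v by (intro exI[of _ "\<lambda>i. a * u i + b * v i"]) auto
qed

text \<open>From a point with a negative coefficient starts a ray in \<open>P\<close> along which that coefficient stays
  negative; it misses \<open>E\<close> and is unbounded.\<close>

lemma conic_comb_bounded_component:
  fixes \<nu> :: "'i \<Rightarrow> real \<times> (real^3)"
  assumes W: "subspace W" and P: "P = {x. coords x \<in> W}" and "finite I" "I \<noteq> {}"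
    and nW: "\<And>i. i \<in> I \<Longrightarrow> \<nu> i \<in> W" "\<And>i. i \<in> I \<Longrightarrow> mink (\<nu> i) (\<nu> i) = 1"
    and span: "\<And>v. v \<in> W \<Longrightarrow> \<exists>a. v = (\<Sum>i\<in>I. a i *\<^sub>R \<nu> i)"
    and ind: "\<And>u i. (\<Sum>i\<in>I. u i *\<^sub>R \<nu> i) = 0 \<Longrightarrow> i \<in> I \<Longrightarrow> u i = 0"
    and E: "\<And>x. x \<in> E \<Longrightarrow> conic_comb I \<nu> x"
    and x: "x \<in> P - E" "bounded (connected_component_set (P - E) x)"
  shows "conic_comb I \<nu> x"
proof (rule ccontr)
  assume nc: "\<not> conic_comb I \<nu> x"
  have xW: "coords x \<in> W" using x(1) P by auto
  obtain a where a: "coords x = (\<Sum>i\<in>I. a i *\<^sub>R \<nu> i)" using span[OF xW] by blast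
  then obtain k where k: "k \<in> I" "a k < 0" using nc by (auto simp: conic_comb_def not_le)
  \<comment> \<open>Any nonzero tangent direction at \<open>x\<close> inside \<open>W\<close> would
    serve; the part of \<open>\<nu> k\<close> orthogonal to \<open>x\<close> is one, having square
    at least 1.\<close>
  define w where "w = \<nu> k + mink (\<nu> k) (coords x) *\<^sub>R coords x"
  have wx: "mink w (coords x) = 0" by (simp add: w_def mink_bilinear mink_coords_self)
  have ww: "mink w w = 1 + (mink (\<nu> k) (coords x))\<^sup>2"
    using nW(2)[OF k(1)] by (simp add: w_def mink_bilinear mink_coords_self mink_commute[of "coords x" "\<nu> k"] power2_eq_square)
  have wpos: "mink w w > 0" unfolding ww by (simp add: add_pos_nonneg)
  have wW: "w \<in> W" unfolding w_def using W nW(1)[OF k(1)] xW by (intro subspace_add subspace_scale)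
  obtain b where b: "w = (\<Sum>i\<in>I. b i *\<^sub>R \<nu> i)" using span[OF wW] by blast
  \<comment> \<open>The sign makes the \<open>k\<close>-th coefficient of the direction nonpositive,
    the denominator makes its length 1.\<close>
  define q where "q = (if b k \<le> 0 then 1 else - 1) / sqrt (mink w w)"
  have q: "q * b k \<le> 0" "q * q * mink w w = 1"
    using wpos by (auto simp: q_def divide_simps mult_nonneg_nonpos)
  define u where "u = q *\<^sub>R w"
  have u: "mink u u = 1" "mink (coords x) u = 0"
    using q wx by (simp_all add: u_def mink_scale mink_commute[of "coords x"] mult.assoc)
  obtain \<gamma> where g: "\<And>s. coords (\<gamma> s) = cosh s *\<^sub>R coords x + sinh s *\<^sub>R u"
    "\<And>s t. dist (\<gamma> s) (\<gamma> t) = \<bar>s - t\<bar>" using coords_ray[OF u] by blast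
  have g0: "\<gamma> 0 = x" using g(1)[of 0] by (simp add: coords_inject)
  define R where "R = \<gamma> ` {0..}"
  have "R \<subseteq> P - E"
  proof
    fix y assume "y \<in> R"
    then obtain s where s: "s \<ge> 0" "y = \<gamma> s" by (auto simp: R_def)
    have "coords y \<in> W" using W xW wW by (simp add: s g u_def subspace_add subspace_scale)
    moreover have "y \<notin> E"
    proof
      assume "y \<in> E"
      then obtain e where e: "\<forall>i\<in>I. e i \<ge> 0" "coords y = (\<Sum>i\<in>I. e i *\<^sub>R \<nu> i)"
        using E by (auto simp: conic_comb_def)
      have "coords y = cosh s *\<^sub>R (\<Sum>i\<in>I. a i *\<^sub>R \<nu> i) + sinh s *\<^sub>R (q *\<^sub>R (\<Sum>i\<in>I. b i *\<^sub>R \<nu> i))"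
        by (simp only: s g u_def flip: a b)
      also have "\<dots> = (\<Sum>i\<in>I. (cosh s * a i + sinh s * (q * b i)) *\<^sub>R \<nu> i)"
        by (simp add: scaleR_sum_right scaleR_add_left sum.distrib)
      finally have "(\<Sum>i\<in>I. (cosh s * a i + sinh s * (q * b i) - e i) *\<^sub>R \<nu> i) = 0"
        using e(2) by (simp add: scaleR_diff_left sum_subtractf)
      then have "cosh s * a k + sinh s * (q * b k) - e k = 0" using k(1) by (rule ind)
      moreover have "cosh s * a k < 0" using k(2) by (simp add: mult_pos_neg cosh_real_pos)
      moreover have "sinh s * (q * b k) \<le> 0" using q(1) s by (simp add: mult_nonneg_nonpos)
      moreover have "e k \<ge> 0" using e k by auto
      ultimately show False by linarith
    qed
    ultimately show "y \<in> P - E" using P by auto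
  qed
  moreover have "connected R"
  proof -
    have "1-lipschitz_on {0..} \<gamma>" by (intro lipschitz_onI) (auto simp: g dist_real_def)
    then show ?thesis unfolding R_def
      by (intro connected_continuous_image lipschitz_on_continuous_on) auto
  qed
  moreover have "x \<in> R" unfolding R_def using g0 by force
  ultimately have "R \<subseteq> connected_component_set (P - E) x"
    by (intro connected_component_maximal)
  then have "bounded R" using x(2) bounded_subset by blast
  then obtain e where "\<forall>y\<in>R. dist x y \<le> e" using bounded_any_center by blast
  then have "dist x (\<gamma> (\<bar>e\<bar> + 1)) \<le> e" by (simp add: R_def)
  then show False using g(2)[of 0 "\<bar>e\<bar> + 1"] g0 by simp
qed

section \<open>The boundary of the universal cover\<close>

lemma half_space_mink: "half_space = {x. 0 \<le> mink (coords x) (0, axis 1 1)}"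
  "half_space_boundary = {x. mink (coords x) (0, axis 1 1) = 0}"
  by (simp_all add: half_space_def half_space_boundary_def mink_def inner_axis)

section \<open>Local geodesics in a metric space\<close>

text \<open>In \<open>N\<close> a local geodesic need not minimise, so only the upper bound
  survives, by adding up steps shorter than \<open>\<delta>\<close>.\<close>

lemma local_lipschitz_segment:
  fixes c :: "real \<Rightarrow> 'a::metric_space"
  assumes "\<delta> > 0"
    and loc: "\<And>s t. \<lbrakk>s \<in> {0..1}; t \<in> {0..1}; \<bar>s - t\<bar> < \<delta>\<rbrakk> \<Longrightarrow> dist (c s) (c t) = \<bar>s - t\<bar> * D"
    and st: "s \<in> {0..1}" "t \<in> {0..1}" "s \<le> t"
  shows "dist (c s) (c t) \<le> (t - s) * D"
proof -
  obtain n where n: "(t - s) / \<delta> < real n" using reals_Archimedean2 by blast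
  have n0: "n > 0" using n st assms(1) by (cases n) (auto simp: field_simps not_less)
  define h where "h = (t - s) / n"
  have h: "h \<ge> 0" "h < \<delta>" "real n * h = t - s" using n n0 st assms(1) by (simp_all add: h_def field_simps)
  define \<tau> where "\<tau> k = s + real k * h" for k
  have tau: "\<tau> k \<in> {0..1}" if "k \<le> n" for k
  proof -
    have "0 \<le> real k * h" "real k * h \<le> real n * h" using that h(1) by (simp_all add: mult_right_mono)
    then show ?thesis using st h by (auto simp: \<tau>_def)
  qed
  have "k \<le> n \<longrightarrow> dist (c (\<tau> 0)) (c (\<tau> k)) \<le> real k * h * D" for k
  proof (induction k)
    case (Suc k)
    show ?case
    proof
      assume k: "Suc k \<le> n"
      have "dist (c (\<tau> k)) (c (\<tau> (Suc k))) = h * D"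
        using loc[OF tau[of k] tau[of "Suc k"]] k h by (simp add: \<tau>_def algebra_simps)
      moreover have "dist (c (\<tau> 0)) (c (\<tau> k)) \<le> real k * h * D" using Suc k by simp
      ultimately show "dist (c (\<tau> 0)) (c (\<tau> (Suc k))) \<le> real (Suc k) * h * D"
        using dist_triangle[of "c (\<tau> 0)" "c (\<tau> (Suc k))" "c (\<tau> k)"] by (simp add: algebra_simps)
    qed
  qed simp
  from this[of n] show ?thesis using h(3) by (simp add: \<tau>_def)
qed

text \<open>Every partition sum telescopes to at most \<open>D\<close>, and a uniform partition
  finer than \<open>\<delta>\<close> attains \<open>D\<close>, even if the ends are closer than
  \<open>D\<close>.\<close>

lemma curve_length_local_geodesic:
  fixes c :: "real \<Rightarrow> 'a::metric_space"
  assumes "\<delta> > 0" "D \<ge> 0"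
    and loc: "\<And>s t. \<lbrakk>s \<in> {0..1}; t \<in> {0..1}; \<bar>s - t\<bar> < \<delta>\<rbrakk> \<Longrightarrow> dist (c s) (c t) = \<bar>s - t\<bar> * D"
  shows "curve_length c = ereal D"
proof (rule antisym)
  show "curve_length c \<le> ereal D"
    unfolding curve_length_def
  proof (rule SUP_least)
    fix ts :: "real list" assume "ts \<in> {ts. sorted ts \<and> set ts \<subseteq> {0..1}}"
    then have ts: "sorted ts" "\<And>i. i < length ts \<Longrightarrow> ts ! i \<in> {0..1}"
      using nth_mem by blast+
    have "(\<Sum>i<length ts - 1. dist (c (ts ! i)) (c (ts ! Suc i))) \<le> (\<Sum>i<length ts - 1. (ts ! Suc i - ts ! i) * D)"
      using ts by (intro sum_mono local_lipschitz_segment[OF assms(1) loc]) (auto intro: sorted_nth_mono)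
    also have "\<dots> = (\<Sum>i<length ts - 1. ts ! Suc i - ts ! i) * D" by (simp add: sum_distrib_right)
    also have "(\<Sum>i<length ts - 1. ts ! Suc i - ts ! i) = ts ! (length ts - 1) - ts ! 0"
      by (rule sum_lessThan_telescope)
    \<comment> \<open>For the empty list both indices are 0, so the difference is still
      zero.\<close>
    also have "(ts ! (length ts - 1) - ts ! 0) * D \<le> 1 * D"
    proof (cases "ts = []")
      case False
      then have "ts ! (length ts - 1) \<in> {0..1}" "ts ! 0 \<in> {0..1}" by (intro ts(2); simp)+
      then show ?thesis using assms(2) by (intro mult_right_mono) auto
    qed (use assms(2) in simp)
    finally show "ereal (\<Sum>i<length ts - 1. dist (c (ts ! i)) (c (ts ! Suc i))) \<le> ereal D" by simp
  qed
  show "ereal D \<le> curve_length c"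
  proof -
    obtain n where n: "1 / \<delta> < real n" using reals_Archimedean2 by blast
    have n0: "n > 0" using n assms(1) by (cases n) (auto simp: field_simps not_less)
    define ts where "ts = map (\<lambda>i. real i / real n) [0..<Suc n]"
    have "sorted ts" unfolding ts_def
      by (rule sorted_map_mono) (auto simp: mono_on_def divide_right_mono simp del: upt_Suc)
    moreover have "set ts \<subseteq> {0..1}" using n0 by (auto simp: ts_def simp del: upt_Suc)
    ultimately have "ereal (\<Sum>i<length ts - 1. dist (c (ts ! i)) (c (ts ! Suc i))) \<le> curve_length c"
      unfolding curve_length_def by (intro SUP_upper) simp
    moreover have "(\<Sum>i<length ts - 1. dist (c (ts ! i)) (c (ts ! Suc i))) = (\<Sum>i<n. 1 / n * D)"
    proof (intro sum.cong)
      fix i assume "i \<in> {..<n}"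
      then have i: "i < n" by simp
      have "dist (c (real i / n)) (c (real (Suc i) / n)) = \<bar>real i / n - real (Suc i) / n\<bar> * D"
      proof (rule loc)
        show "\<bar>real i / n - real (Suc i) / n\<bar> < \<delta>"
          using n n0 assms(1) by (simp add: field_simps)
      qed (use i in auto)
      also have "\<bar>real i / n - real (Suc i) / n\<bar> = 1 / n" using n0 by (simp add: field_simps)
      finally show "dist (c (ts ! i)) (c (ts ! Suc i)) = 1 / n * D"
        using i by (simp add: ts_def del: upt_Suc)
    qed (simp add: ts_def)
    moreover have "(\<Sum>i<n. 1 / n * D) = D" using n0 by simp
    ultimately show ?thesis by simp
  qed
qed

section \<open>Charts and boundary points\<close>

text \<open>Off the bounding plane the image of a chart contains a full ball of hyperbolic space,
  and a chart is inverted isometrically there. A small radius keeps the inverse inside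
  \<open>V\<close>.\<close>

lemma hyp_chart_local_inverse:
  assumes ch: "hyp_chart N U \<phi>" and y: "y \<in> U" "\<phi> y \<notin> half_space_boundary" and V: "openin (top_of_set N) V" "y \<in> V"
  obtains \<delta> h where "\<delta> > 0" "h (\<phi> y) = y" "\<And>z. z \<in> ball (\<phi> y) \<delta> \<Longrightarrow> h z \<in> V"
    "\<And>z z'. z \<in> ball (\<phi> y) \<delta> \<Longrightarrow> z' \<in> ball (\<phi> y) \<delta> \<Longrightarrow> dist (h z) (h z') = dist z z'"
proof -
  have U: "openin (top_of_set N) U" "openin (top_of_set half_space) (\<phi> ` U)"
    and iso: "\<And>a b. a \<in> U \<Longrightarrow> b \<in> U \<Longrightarrow> dist (\<phi> a) (\<phi> b) = dist a b"
    using ch by (auto simp: hyp_chart_def)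
  obtain G where G: "open G" "\<phi> ` U = half_space \<inter> G" using U(2) openin_open by metis
  obtain V' where V': "open V'" "V = N \<inter> V'" using V(1) openin_open by metis
  have UN: "U \<subseteq> N" using U(1) openin_imp_subset by blast
  define H where "H = {x. 0 < mink (coords x) (0, axis 1 1)}"
  have "open H" unfolding H_def by (intro open_Collect_less continuous_intros)
  have "\<phi> y \<in> \<phi> ` U" using y by blast
  then have "\<phi> y \<in> H" "\<phi> y \<in> G" using y G(2) by (auto simp: half_space_mink H_def)
  then obtain d1 where d1: "d1 > 0" "ball (\<phi> y) d1 \<subseteq> H \<inter> G"
    using open_contains_ball[of "H \<inter> G"] \<open>open H\<close> G(1) by blast
  have "y \<in> V'" using V V' by blast
  then obtain d2 where d2: "d2 > 0" "ball y d2 \<subseteq> V'"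
    using open_contains_ball[of V'] V'(1) by blast
  define \<delta> where "\<delta> = min d1 d2"
  have inU: "z \<in> \<phi> ` U" if "z \<in> ball (\<phi> y) \<delta>" for z
  proof -
    have "z \<in> H \<inter> G" using d1(2) that by (auto simp: \<delta>_def)
    then show ?thesis using G(2) by (auto simp: H_def half_space_mink)
  qed
  define h where "h = inv_into U \<phi>"
  have hU: "h z \<in> U" "\<phi> (h z) = z" if "z \<in> ball (\<phi> y) \<delta>" for z
    using inv_into_into[OF inU[OF that]] f_inv_into_f[OF inU[OF that]] by (simp_all add: h_def)
  have c: "\<phi> y \<in> ball (\<phi> y) \<delta>" using d1 d2 by (simp add: \<delta>_def)
  have hiso: "dist (h z) (h z') = dist z z'" if "z \<in> ball (\<phi> y) \<delta>" "z' \<in> ball (\<phi> y) \<delta>" for z z'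
    using iso[OF hU(1)[OF that(1)] hU(1)[OF that(2)]] hU(2)[OF that(1)] hU(2)[OF that(2)] by simp
  have hy: "h (\<phi> y) = y"
    using iso[OF hU(1)[OF c] y(1)] hU(2)[OF c] by simp
  have "h z \<in> V" if z: "z \<in> ball (\<phi> y) \<delta>" for z
  proof -
    have "dist y (h z) = dist (\<phi> y) z" using hiso[OF c z] hy by simp
    then have "h z \<in> ball y d2" using z by (simp add: \<delta>_def)
    then show ?thesis using d2(2) V'(2) UN hU(1)[OF z] by blast
  qed
  moreover have "\<delta> > 0" using d1 d2 by (simp add: \<delta>_def)
  ultimately show thesis using that[of \<delta> h] hy hiso by blast
qed

text \<open>\<open>mfd_boundary\<close> asks for a single chart only. If another chart showed the
  point as interior, its inverse followed by the first chart would map a ball isometrically into the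
  half-space with its centre on the bounding plane.\<close>

lemma hyp_chart_boundary:
  assumes ch: "hyp_chart N U \<phi>" and y: "y \<in> U" "y \<in> mfd_boundary N"
  shows "\<phi> y \<in> half_space_boundary"
proof (rule ccontr)
  assume nb: "\<phi> y \<notin> half_space_boundary"
  obtain V \<psi> where V: "y \<in> V" "hyp_chart N V \<psi>" "\<psi> y \<in> half_space_boundary"
    using y(2) by (auto simp: mfd_boundary_def)
  have oV: "openin (top_of_set N) V" and iso: "\<And>a b. a \<in> V \<Longrightarrow> b \<in> V \<Longrightarrow> dist (\<psi> a) (\<psi> b) = dist a b"
    and hs: "\<psi> ` V \<subseteq> half_space"
    using V(2) openin_imp_subset[of _ half_space "\<psi> ` V"] by (auto simp: hyp_chart_def)
  obtain \<delta> h where h: "\<delta> > 0" "h (\<phi> y) = y" "\<And>z. z \<in> ball (\<phi> y) \<delta> \<Longrightarrow> h z \<in> V"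
    "\<And>z z'. z \<in> ball (\<phi> y) \<delta> \<Longrightarrow> z' \<in> ball (\<phi> y) \<delta> \<Longrightarrow> dist (h z) (h z') = dist z z'"
    using hyp_chart_local_inverse[OF ch y(1) nb oV V(1)] by blast
  show False
  proof (rule no_isometry_ball_to_half_space[of "\<phi> y" \<delta> "\<psi> \<circ> h" "- (0, axis 1 1)"])
    show "dist ((\<psi> \<circ> h) a) ((\<psi> \<circ> h) b) = dist a b" if "a \<in> ball (\<phi> y) \<delta>" "b \<in> ball (\<phi> y) \<delta>" for a b
      using iso[OF h(3)[OF that(1)] h(3)[OF that(2)]] h(4)[OF that] by simp
    show "mink (coords ((\<psi> \<circ> h) a)) (- (0, axis 1 1)) \<le> 0" if "a \<in> ball (\<phi> y) \<delta>" for a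
    proof -
      have "\<psi> (h a) \<in> half_space" using h(3)[OF that] hs by blast
      then show ?thesis by (simp only: o_def mink_minus half_space_mink mem_Collect_eq neg_le_0_iff_le)
    qed
    show "mink (coords ((\<psi> \<circ> h) (\<phi> y))) (- (0, axis 1 1)) = 0"
      using V(3) h(2) by (simp only: o_def mink_minus half_space_mink mem_Collect_eq neg_equal_0_iff_equal)
    show "- (0 :: real, axis 1 1 :: real^3) \<noteq> 0" by (simp add: prod_eq_iff axis_eq_0_iff)
  qed (rule h(1))
qed

section \<open>Walls of the universal cover\<close>

locale hyp_cover =
  fixes X :: "hyp3 set" and p :: "hyp3 \<Rightarrow> 'n::metric_space" and N :: "'n set"
  assumes mfd: "hyperbolic_3_manifold N"
    and compact_boundary: "compact (mfd_boundary N)"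
    and cover: "hyp_universal_cover X p N"
begin

abbreviation walls :: "hyp3 set set" where
  "walls \<equiv> components (frontier X)"

lemma closed_X: "closed X" and convex_X: "geodesically_convex X"
  and covering: "covering_space X p N"
  using cover by (auto simp: hyp_universal_cover_def)

lemma frontier_subset_X: "frontier X \<subseteq> X"
  using closed_X by (rule frontier_subset_closed)

lemma walls_subset: "A \<in> walls \<Longrightarrow> A \<subseteq> frontier X" "A \<in> walls \<Longrightarrow> A \<subseteq> X"
  using in_components_subset frontier_subset_X by blast+

lemma wall_through:
  assumes "x \<in> frontier X"
  obtains A where "A \<in> walls" "x \<in> A"
  using that[of "connected_component_set (frontier X) x"] assms
  by (auto simp: components_def)

lemma walls_eq:
  assumes "connected T" "T \<subseteq> frontier X" "A \<in> walls" "B \<in> walls" "A \<inter> T \<noteq> {}" "B \<inter> T \<noteq> {}"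
  shows "A = B"
  using joinable_components_eq assms by metis

lemma local_isometry:
  assumes "x \<in> X"
  obtains r where "r > 0" "\<And>y z. y \<in> ball x r \<inter> X \<Longrightarrow> z \<in> ball x r \<inter> X \<Longrightarrow> dist (p y) (p z) = dist y z"
  using cover assms unfolding hyp_universal_cover_def by metis

lemma wall_support:
  assumes "A \<in> walls"
  shows "\<exists>n. mink n n = 1 \<and> A = {x. mink (coords x) n = 0} \<and> (\<forall>x\<in>X. mink (coords x) n \<le> 0)"
proof -
  have "hyp_plane A" using cover assms by (auto simp: hyp_universal_cover_def)
  moreover have "A \<inter> interior X = {}" using walls_subset(1)[OF assms] by (auto simp: frontier_def)
  ultimately obtain n where "mink n n = 1" "A = {x. mink (coords x) n = 0}"
    "\<And>x. x \<in> X \<Longrightarrow> mink (coords x) n \<le> 0"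
    using frontier_plane_supports[OF convex_X walls_subset(2)[OF assms]] by blast
  then show ?thesis by blast
qed

text \<open>The condition on \<open>X\<close> selects the outward orientation, which makes the
  products of normals of distinct walls negative.\<close>

definition normal :: "hyp3 set \<Rightarrow> real \<times> (real^3)" where
  "normal A = (SOME n. mink n n = 1 \<and> A = {x. mink (coords x) n = 0} \<and> (\<forall>x\<in>X. mink (coords x) n \<le> 0))"

lemma normal:
  assumes "A \<in> walls"
  shows "mink (normal A) (normal A) = 1" "x \<in> A \<longleftrightarrow> mink (coords x) (normal A) = 0"
    "x \<in> X \<Longrightarrow> mink (coords x) (normal A) \<le> 0"
proof -
  have *: "mink (normal A) (normal A) = 1 \<and> A = {x. mink (coords x) (normal A) = 0} \<and> (\<forall>x\<in>X. mink (coords x) (normal A) \<le> 0)"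
    unfolding normal_def by (rule someI_ex[OF wall_support[OF assms]])
  show "mink (normal A) (normal A) = 1" by (rule conjunct1[OF *])
  show "x \<in> A \<longleftrightarrow> mink (coords x) (normal A) = 0"
    by (subst conjunct1[OF conjunct2[OF *]]) (rule mem_Collect_eq)
  show "x \<in> X \<Longrightarrow> mink (coords x) (normal A) \<le> 0"
    by (rule bspec[OF conjunct2[OF conjunct2[OF *]]])
qed

lemma in_X_image: "x \<in> X \<Longrightarrow> p x \<in> N"
  using covering_space_imp_surjective[OF covering] by blast

lemma chart_at:
  assumes "x \<in> N"
  obtains U \<phi> where "x \<in> U" "hyp_chart N U \<phi>"
  using mfd assms unfolding hyperbolic_3_manifold_def by metis

text \<open>If \<open>p x\<close> were interior, a chart inverse followed by a local inverse of
  \<open>p\<close> would map a hyperbolic ball isometrically into \<open>X\<close>, with its centre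
  on a wall, against \<open>no_isometry_ball_to_half_space\<close>.\<close>

lemma frontier_image:
  assumes x: "x \<in> frontier X"
  shows "p x \<in> mfd_boundary N"
proof (rule ccontr)
  assume nb: "p x \<notin> mfd_boundary N"
  obtain A where A: "A \<in> walls" "x \<in> A" using wall_through[OF x] by blast
  have xX: "x \<in> X" using x frontier_subset_X by blast
  obtain r where r: "r > 0" "\<And>y z. y \<in> ball x r \<inter> X \<Longrightarrow> z \<in> ball x r \<inter> X \<Longrightarrow> dist (p y) (p z) = dist y z"
    using local_isometry[OF xX] by blast
  define B where "B = ball x r \<inter> X"
  have "openin (top_of_set X) B" unfolding B_def by (metis Int_commute open_ball openin_open_Int)
  then have V: "openin (top_of_set N) (p ` B)" by (rule covering_space_open_map[OF covering])
  have xB: "x \<in> B" using r xX by (simp add: B_def)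
  obtain U \<phi> where U: "p x \<in> U" "hyp_chart N U \<phi>" using chart_at[OF in_X_image[OF xX]] by blast
  have nb': "\<phi> (p x) \<notin> half_space_boundary" using nb U by (auto simp: mfd_boundary_def)
  obtain \<delta> h where h: "\<delta> > 0" "h (\<phi> (p x)) = p x" "\<And>z. z \<in> ball (\<phi> (p x)) \<delta> \<Longrightarrow> h z \<in> p ` B"
    "\<And>z z'. z \<in> ball (\<phi> (p x)) \<delta> \<Longrightarrow> z' \<in> ball (\<phi> (p x)) \<delta> \<Longrightarrow> dist (h z) (h z') = dist z z'"
    using hyp_chart_local_inverse[OF U(2,1) nb' V imageI[OF xB]] by blast
  define f where "f z = inv_into B p (h z)" for z
  have fB: "f z \<in> B" "p (f z) = h z" if "z \<in> ball (\<phi> (p x)) \<delta>" for z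
    using inv_into_into[OF h(3)[OF that]] f_inv_into_f[OF h(3)[OF that]] by (simp_all add: f_def)
  have c: "\<phi> (p x) \<in> ball (\<phi> (p x)) \<delta>" using h(1) by simp
  show False
  proof (rule no_isometry_ball_to_half_space[of "\<phi> (p x)" \<delta> f "normal A"])
    show "dist (f a) (f b) = dist a b" if "a \<in> ball (\<phi> (p x)) \<delta>" "b \<in> ball (\<phi> (p x)) \<delta>" for a b
      using r(2)[folded B_def, OF fB(1)[OF that(1)] fB(1)[OF that(2)]] fB(2)[OF that(1)] fB(2)[OF that(2)] h(4)[OF that] by simp
    show "mink (coords (f a)) (normal A) \<le> 0" if "a \<in> ball (\<phi> (p x)) \<delta>" for a
      using fB(1)[OF that] normal(3)[OF A(1)] by (simp add: B_def)
    have "f (\<phi> (p x)) = x" using r(2)[folded B_def, OF fB(1)[OF c] xB] fB(2)[OF c] h(2) by simp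
    then show "mink (coords (f (\<phi> (p x)))) (normal A) = 0" using normal(2)[OF A(1)] A(2) by simp
    show "normal A \<noteq> 0" using normal(1)[OF A(1)] by (auto simp: mink_zero)
  qed (rule h(1))
qed

text \<open>The opposite transport: around an interior point of \<open>X\<close>, \<open>p\<close>
  followed by a chart would map a ball isometrically into the half-space with its centre on the
  bounding plane.\<close>

lemma boundary_preimage:
  assumes xX: "x \<in> X" and bd: "p x \<in> mfd_boundary N"
  shows "x \<in> frontier X"
proof (rule ccontr)
  assume "x \<notin> frontier X"
  then have "x \<in> interior X" using xX closed_X by (simp add: frontier_def)
  then obtain r1 where r1: "r1 > 0" "ball x r1 \<subseteq> X" by (auto simp: mem_interior)
  obtain r2 where r2: "r2 > 0" "\<And>y z. y \<in> ball x r2 \<inter> X \<Longrightarrow> z \<in> ball x r2 \<inter> X \<Longrightarrow> dist (p y) (p z) = dist y z"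
    using local_isometry[OF xX] by blast
  obtain U \<phi> where U: "p x \<in> U" "hyp_chart N U \<phi>" "\<phi> (p x) \<in> half_space_boundary"
    using bd by (auto simp: mfd_boundary_def)
  have oU: "openin (top_of_set N) U" and iso: "\<And>a b. a \<in> U \<Longrightarrow> b \<in> U \<Longrightarrow> dist (\<phi> a) (\<phi> b) = dist a b"
    and hs: "\<phi> ` U \<subseteq> half_space"
    using U(2) openin_imp_subset[of _ half_space "\<phi> ` U"] by (auto simp: hyp_chart_def)
  obtain G where G: "open G" "U = N \<inter> G" using oU openin_open by metis
  then obtain e where e: "e > 0" "ball (p x) e \<subseteq> G" using U(1) open_contains_ball by blast
  define r where "r = min e (min r1 r2)"
  have rX: "y \<in> ball x r2 \<inter> X" if "y \<in> ball x r" for y using that r1(2) by (auto simp: r_def)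
  have r: "r > 0" using e r1 r2 by (simp add: r_def)
  have inU: "p y \<in> U" if y: "y \<in> ball x r" for y
  proof -
    have "dist (p x) (p y) = dist x y" using r2(2)[OF rX rX[OF y], of x] r by simp
    then have "p y \<in> ball (p x) e" using y by (simp add: r_def)
    then show ?thesis using e(2) G(2) in_X_image rX[OF y] by blast
  qed
  show False
  proof (rule no_isometry_ball_to_half_space[of x r "\<phi> \<circ> p" "- (0, axis 1 1)"])
    show "dist ((\<phi> \<circ> p) a) ((\<phi> \<circ> p) b) = dist a b" if "a \<in> ball x r" "b \<in> ball x r" for a b
      using iso[OF inU[OF that(1)] inU[OF that(2)]] r2(2)[OF rX[OF that(1)] rX[OF that(2)]] by simp
    show "mink (coords ((\<phi> \<circ> p) a)) (- (0, axis 1 1)) \<le> 0" if "a \<in> ball x r" for a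
    proof -
      have "\<phi> (p a) \<in> half_space" using inU[OF that] hs by blast
      then show ?thesis by (simp only: o_def mink_minus half_space_mink mem_Collect_eq neg_le_0_iff_le)
    qed
    show "mink (coords ((\<phi> \<circ> p) x)) (- (0, axis 1 1)) = 0"
      using U(3) by (simp only: o_def mink_minus half_space_mink mem_Collect_eq neg_equal_0_iff_equal)
    show "- (0 :: real, axis 1 1 :: real^3) \<noteq> 0" by (simp add: prod_eq_iff axis_eq_0_iff)
  qed (rule r)
qed

section \<open>Projecting paths and separating walls\<close>

text \<open>The radius of local isometry depends on the point; a Lebesgue number along the compact
  path makes it uniform.\<close>

lemma path_local_isometry:
  assumes "path \<gamma>" "path_image \<gamma> \<subseteq> X"
  obtains \<delta> where "\<delta> > 0"
    "\<And>s t. \<lbrakk>s \<in> {0..1}; t \<in> {0..1}; \<bar>s - t\<bar> < \<delta>\<rbrakk> \<Longrightarrow> dist (p (\<gamma> s)) (p (\<gamma> t)) = dist (\<gamma> s) (\<gamma> t)"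
proof -
  define \<G> where "\<G> = {G. open G \<and> (\<forall>y\<in>G \<inter> X. \<forall>z\<in>G \<inter> X. dist (p y) (p z) = dist y z)}"
  have "compact (path_image \<gamma>)" using assms(1) by (rule compact_path_image)
  moreover have "path_image \<gamma> \<subseteq> \<Union>\<G>"
  proof
    fix x assume "x \<in> path_image \<gamma>"
    then obtain r where r: "r > 0" "\<And>y z. y \<in> ball x r \<inter> X \<Longrightarrow> z \<in> ball x r \<inter> X \<Longrightarrow> dist (p y) (p z) = dist y z"
      using local_isometry[of x] assms(2) by blast
    then have "ball x r \<in> \<G>" by (auto simp: \<G>_def)
    then show "x \<in> \<Union>\<G>" using r(1) by (meson UnionI centre_in_ball)
  qed
  ultimately obtain e where e: "e > 0" "\<And>x. x \<in> path_image \<gamma> \<Longrightarrow> \<exists>G\<in>\<G>. ball x e \<subseteq> G"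
    by (rule Heine_Borel_lemma) (auto simp: \<G>_def)
  have "uniformly_continuous_on {0..1} \<gamma>"
    using assms(1) by (intro compact_uniformly_continuous) (auto simp: path_def)
  then obtain \<delta> where \<delta>: "\<delta> > 0" "\<And>s t. s \<in> {0..1} \<Longrightarrow> t \<in> {0..1} \<Longrightarrow> dist t s < \<delta> \<Longrightarrow> dist (\<gamma> t) (\<gamma> s) < e"
    using e(1) unfolding uniformly_continuous_on_def by metis
  show thesis
  proof (rule that[OF \<delta>(1)])
    fix s t :: real assume st: "s \<in> {0..1}" "t \<in> {0..1}" "\<bar>s - t\<bar> < \<delta>"
    then have im: "\<gamma> s \<in> path_image \<gamma>" "\<gamma> t \<in> path_image \<gamma>" by (auto simp: path_image_def)
    obtain G where G: "G \<in> \<G>" "ball (\<gamma> s) e \<subseteq> G" using e(2)[OF im(1)] by blast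
    have "dist (\<gamma> s) (\<gamma> t) < e" using \<delta>(2)[OF st(2,1)] st(3) by (simp add: dist_real_def)
    then have "\<gamma> s \<in> G \<inter> X" "\<gamma> t \<in> G \<inter> X" using G(2) im assms(2) e(1) by auto
    then show "dist (p (\<gamma> s)) (p (\<gamma> t)) = dist (\<gamma> s) (\<gamma> t)" using G(1) by (auto simp: \<G>_def)
  qed
qed

lemma geodesic_projection:
  assumes g: "geodesic_path g" "path_image g \<subseteq> X"
  obtains \<delta> where "\<delta> > 0"
    "\<And>s t. \<lbrakk>s \<in> {0..1}; t \<in> {0..1}; \<bar>s - t\<bar> < \<delta>\<rbrakk> \<Longrightarrow>
      dist (p (g s)) (p (g t)) = \<bar>s - t\<bar> * dist (pathstart g) (pathfinish g)"
proof -
  obtain \<delta> where d: "\<delta> > 0"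
    "\<And>s t. \<lbrakk>s \<in> {0..1}; t \<in> {0..1}; \<bar>s - t\<bar> < \<delta>\<rbrakk> \<Longrightarrow> dist (p (g s)) (p (g t)) = dist (g s) (g t)"
    using path_local_isometry[OF geodesic_path_imp_path[OF g(1)] g(2)] by blast
  show thesis
  proof (rule that[OF d(1)])
    fix s t :: real assume st: "s \<in> {0..1}" "t \<in> {0..1}" "\<bar>s - t\<bar> < \<delta>"
    show "dist (p (g s)) (p (g t)) = \<bar>s - t\<bar> * dist (pathstart g) (pathfinish g)"
      using d(2)[OF st] geodesic_path_dist[OF g(1) st(1,2)] by simp
  qed
qed

lemma curve_length_projection:
  assumes g: "geodesic_path g" "path_image g \<subseteq> X" and c: "\<And>t. t \<in> {0..1} \<Longrightarrow> c t = p (g t)"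
  shows "curve_length c = ereal (dist (pathstart g) (pathfinish g))"
proof -
  obtain \<delta> where d: "\<delta> > 0"
    "\<And>s t. \<lbrakk>s \<in> {0..1}; t \<in> {0..1}; \<bar>s - t\<bar> < \<delta>\<rbrakk> \<Longrightarrow>
      dist (p (g s)) (p (g t)) = \<bar>s - t\<bar> * dist (pathstart g) (pathfinish g)"
    using geodesic_projection[OF g] by blast
  show ?thesis
    by (rule curve_length_local_geodesic[OF d(1) zero_le_dist]) (simp add: c d(2))
qed

lemma segment_in_X:
  assumes "geodesic_path g" "pathstart g \<in> X" "pathfinish g \<in> X"
  shows "path_image g \<subseteq> X"
  using convex_X assms unfolding geodesically_convex_def by blast

text \<open>If \<open>a\<close> and \<open>b\<close> are closer than a Lebesgue number of the cover of the boundary by charts, the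
  geodesic between them projects into one chart, where it joins two points of a plane and hence stays in
  that plane. So the whole geodesic lies in the frontier.\<close>

lemma walls_separated:
  obtains \<epsilon> where "\<epsilon> > 0"
    "\<And>A B a b. \<lbrakk>A \<in> walls; B \<in> walls; A \<noteq> B; a \<in> A; b \<in> B\<rbrakk> \<Longrightarrow> dist a b \<ge> \<epsilon>"
proof -
  define \<G> where "\<G> = {G. open G \<and> (\<exists>\<phi>. hyp_chart N (N \<inter> G) \<phi>)}"
  have "mfd_boundary N \<subseteq> \<Union>\<G>"
  proof
    fix x assume "x \<in> mfd_boundary N"
    then obtain U \<phi> where U: "x \<in> U" "hyp_chart N U \<phi>" by (auto simp: mfd_boundary_def)
    then obtain G where "open G" "U = N \<inter> G" using openin_open unfolding hyp_chart_def by metis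
    then show "x \<in> \<Union>\<G>" using U by (auto simp: \<G>_def)
  qed
  with compact_boundary obtain \<epsilon> where e: "\<epsilon> > 0" "\<And>x. x \<in> mfd_boundary N \<Longrightarrow> \<exists>G\<in>\<G>. ball x \<epsilon> \<subseteq> G"
    by (rule Heine_Borel_lemma) (auto simp: \<G>_def)
  show thesis
  proof (rule that[OF e(1)], rule ccontr)
    fix A B a b
    assume AB: "A \<in> walls" "B \<in> walls" "A \<noteq> B" "a \<in> A" "b \<in> B" and lt: "\<not> \<epsilon> \<le> dist a b"
    have bd: "p a \<in> mfd_boundary N" "p b \<in> mfd_boundary N"
      using AB walls_subset(1) by (auto intro!: frontier_image)
    obtain G \<phi> where G: "ball (p a) \<epsilon> \<subseteq> G" "hyp_chart N (N \<inter> G) \<phi>"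
      using e(2)[OF bd(1)] by (auto simp: \<G>_def)
    have iso: "\<And>a b. a \<in> N \<inter> G \<Longrightarrow> b \<in> N \<inter> G \<Longrightarrow> dist (\<phi> a) (\<phi> b) = dist a b"
      using G(2) by (auto simp: hyp_chart_def)
    obtain g where g: "geodesic_path g" "pathstart g = a" "pathfinish g = b" by (rule geodesic_path_exists)
    have gX: "path_image g \<subseteq> X" using AB walls_subset(2) by (intro segment_in_X) (auto simp: g)
    obtain \<delta> where d: "\<delta> > 0"
      "\<And>s t. \<lbrakk>s \<in> {0..1}; t \<in> {0..1}; \<bar>s - t\<bar> < \<delta>\<rbrakk> \<Longrightarrow>
        dist (p (g s)) (p (g t)) = \<bar>s - t\<bar> * dist a b"
      using geodesic_projection[OF g(1) gX] unfolding g by blast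
    have inG: "p (g t) \<in> N \<inter> G" if t: "t \<in> {0..1}" for t
    proof -
      \<comment> \<open>The projected segment need not minimise, but its length
        \<open>dist a b\<close> still bounds how far it strays from \<open>p a\<close>.\<close>
      have "dist (p (g 0)) (p (g t)) \<le> (t - 0) * dist a b"
        using t by (intro local_lipschitz_segment[OF d]) auto
      also have "\<dots> \<le> 1 * dist a b" using t by (intro mult_right_mono) auto
      also have "\<dots> < \<epsilon>" using lt by simp
      finally have "p (g t) \<in> ball (p a) \<epsilon>" using g(2) by (simp add: pathstart_def)
      moreover have "g t \<in> X" using gX t by (auto simp: path_image_def)
      ultimately show ?thesis using G(1) in_X_image by blast
    qed
    \<comment> \<open>In the chart the segment becomes a local geodesic of hyperbolic space, hence a
      geodesic, whose vectors are combinations of the two ends.\<close>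
    have q: "geodesic_path (\<lambda>t. \<phi> (p (g t)))"
    proof (rule local_geodesic_imp_geodesic[OF d(1) zero_le_dist])
      fix s t :: real assume st: "s \<in> {0..1}" "t \<in> {0..1}" "\<bar>s - t\<bar> < \<delta>"
      show "dist (\<phi> (p (g s))) (\<phi> (p (g t))) = \<bar>s - t\<bar> * dist a b"
        using iso[OF inG[OF st(1)] inG[OF st(2)]] d(2)[OF st] by simp
    qed
    have ends: "\<phi> (p (g 0)) \<in> half_space_boundary" "\<phi> (p (g 1)) \<in> half_space_boundary"
      using hyp_chart_boundary[OF G(2) inG[of 0]] hyp_chart_boundary[OF G(2) inG[of 1]] bd g(2,3)
      by (simp_all add: pathstart_def pathfinish_def)
    have "path_image g \<subseteq> frontier X"
    proof
      fix z assume "z \<in> path_image g"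
      then obtain t where t: "t \<in> {0..1}" "z = g t" by (auto simp: path_image_def)
      then have "\<phi> (p (g t)) \<in> path_image (\<lambda>t. \<phi> (p (g t)))" by (auto simp: path_image_def)
      then obtain u v where "coords (\<phi> (p (g t))) = u *\<^sub>R coords (\<phi> (p (g 0))) + v *\<^sub>R coords (\<phi> (p (g 1)))"
        using geodesic_path_conic[OF q] unfolding pathstart_def pathfinish_def by metis
      then have "\<phi> (p (g t)) \<in> half_space_boundary"
        using ends by (simp add: half_space_mink mink_bilinear)
      then have "p (g t) \<in> mfd_boundary N" using G(2) inG[OF t(1)] by (auto simp: mfd_boundary_def)
      moreover have "g t \<in> X" using gX t by (auto simp: path_image_def)
      ultimately show "z \<in> frontier X" using t(2) boundary_preimage by blast
    qed
    moreover have "connected (path_image g)"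
      by (rule connected_path_image[OF geodesic_path_imp_path[OF g(1)]])
    ultimately have "A = B"
      using walls_eq[of "path_image g" A B] AB g pathstart_in_path_image[of g] pathfinish_in_path_image[of g] by auto
    then show False using AB(3) by simp
  qed
qed

end

section \<open>Short cuts, lifts and hexagons\<close>

lemma conic_comb_pair:
  assumes "finite I" "A \<in> I" "B \<in> I" "A \<noteq> B" "a \<ge> 0" "b \<ge> 0" "coords x = a *\<^sub>R \<nu> A + b *\<^sub>R \<nu> B"
  shows "conic_comb I \<nu> x"
proof -
  define u where "u i = (if i = A then a else if i = B then b else 0)" for i
  have "(\<Sum>i\<in>I. u i *\<^sub>R \<nu> i) = (\<Sum>i\<in>{A, B}. u i *\<^sub>R \<nu> i)"
    using assms(1-3) by (intro sum.mono_neutral_right) (auto simp: u_def)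
  also have "\<dots> = coords x" using assms(4) by (simp add: u_def assms(7))
  finally show ?thesis using assms(5,6) unfolding conic_comb_def by (intro exI[of _ u]) (auto simp: u_def)
qed

text \<open>Phrased for families because coefficients are indexed by walls; injectivity carries the
  dimension count over to the set of normals.\<close>

lemma span_family:
  fixes \<nu> :: "'i \<Rightarrow> 'v::euclidean_space"
  assumes "finite I" "inj_on \<nu> I" "\<nu> ` I \<subseteq> W" "dim W \<le> card I"
    and ind: "\<And>u i. (\<Sum>i\<in>I. u i *\<^sub>R \<nu> i) = 0 \<Longrightarrow> i \<in> I \<Longrightarrow> u i = 0"
    and "v \<in> W"
  shows "\<exists>a. v = (\<Sum>i\<in>I. a i *\<^sub>R \<nu> i)"
proof -
  have "independent (\<nu> ` I)"
  proof (rule independent_if_scalars_zero)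
    fix f x assume f: "(\<Sum>x\<in>\<nu> ` I. f x *\<^sub>R x) = 0" "x \<in> \<nu> ` I"
    then obtain i where i: "i \<in> I" "x = \<nu> i" by blast
    have "(\<Sum>i\<in>I. f (\<nu> i) *\<^sub>R \<nu> i) = 0" using f(1) assms(2) by (simp add: sum.reindex)
    then show "f x = 0" using ind[of "\<lambda>i. f (\<nu> i)" i] i by simp
  qed (use assms(1) in simp)
  then have "W \<subseteq> span (\<nu> ` I)"
    using assms(3,4) card_image[OF assms(2)] by (intro card_ge_dim_independent) auto
  then have "v \<in> range (\<lambda>u. \<Sum>x\<in>\<nu> ` I. u x *\<^sub>R x)"
    using assms(1,6) span_finite[of "\<nu> ` I"] by auto
  then obtain u where "v = (\<Sum>x\<in>\<nu> ` I. u x *\<^sub>R x)" by blast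
  also have "\<dots> = (\<Sum>i\<in>I. u (\<nu> i) *\<^sub>R \<nu> i)" using assms(2) by (simp add: sum.reindex)
  finally show ?thesis by (intro exI[of _ "\<lambda>i. u (\<nu> i)"])
qed

lemma short_cut_between_reverse:
  assumes "short_cut_between A B g"
  shows "short_cut_between B A (reversepath g)"
proof -
  have g: "geodesic_path g" "pathstart g \<in> A" "pathfinish g \<in> B"
    "\<And>a b. a \<in> A \<Longrightarrow> b \<in> B \<Longrightarrow> dist (pathstart g) (pathfinish g) \<le> dist a b"
    using assms by (auto simp: short_cut_between_def)
  have "dist (pathfinish g) (pathstart g) \<le> dist b a" if "a \<in> A" "b \<in> B" for a b
    using g(4)[OF that] by (simp only: dist_commute)
  then show ?thesis using g(1-3) by (simp add: short_cut_between_def geodesic_path_reversepath)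
qed

context hyp_cover
begin

section \<open>Short cuts as common perpendiculars\<close>

lemma wall_perpendicular:
  assumes A: "A \<in> walls" and B: "B \<in> walls" and AB: "A \<noteq> B"
  obtains k r a0 b0 where "k > 1" "r > 0" "mink (normal A) (normal B) = - k"
    "coords a0 = r *\<^sub>R (normal B + k *\<^sub>R normal A)" "coords b0 = r *\<^sub>R (normal A + k *\<^sub>R normal B)"
    "a0 \<in> A" "b0 \<in> B" "cosh (dist a0 b0) = k"
    "\<forall>a\<in>A. \<forall>b\<in>B. dist a0 b0 \<le> dist a b \<and> (dist a b = dist a0 b0 \<longrightarrow> a = a0 \<and> b = b0)"
proof -
  note nA = normal[OF A] and nB = normal[OF B]
  obtain a' b' where ab: "a' \<in> A" "b' \<in> B"
    using A B in_components_nonempty by blast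
  obtain \<epsilon> where e: "\<epsilon> > 0"
    "\<And>A B a b. \<lbrakk>A \<in> walls; B \<in> walls; A \<noteq> B; a \<in> A; b \<in> B\<rbrakk> \<Longrightarrow> dist a b \<ge> \<epsilon>"
    using walls_separated by blast
  have 1: "mink (coords a) (normal B) \<le> 0" if "mink (coords a) (normal A) = 0" for a
    using that nA(2) nB(3) walls_subset(2)[OF A] by blast
  have 2: "mink (coords b) (normal A) \<le> 0" if "mink (coords b) (normal B) = 0" for b
    using that nB(2) nA(3) walls_subset(2)[OF B] by blast
  have 3: "dist a b \<ge> \<epsilon>" if "mink (coords a) (normal A) = 0" "mink (coords b) (normal B) = 0" for a b
    using that e(2)[OF A B AB] nA(2) nB(2) by blast
  show thesis
  proof (rule common_perpendicular[OF nA(1) nB(1) 1 ab(1)[unfolded nA(2)] 2 ab(2)[unfolded nB(2)] e(1) 3])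
    fix k r a0 b0
    assume k: "k > 1" "r > 0" "mink (normal A) (normal B) = - k"
    "coords a0 = r *\<^sub>R (normal B + k *\<^sub>R normal A)" "coords b0 = r *\<^sub>R (normal A + k *\<^sub>R normal B)"
    "mink (coords a0) (normal A) = 0" "mink (coords b0) (normal B) = 0" "cosh (dist a0 b0) = k"
    "\<And>a b. mink (coords a) (normal A) = 0 \<Longrightarrow> mink (coords b) (normal B) = 0 \<Longrightarrow>
      dist a0 b0 \<le> dist a b \<and> (dist a b = dist a0 b0 \<longrightarrow> a = a0 \<and> b = b0)"
    show thesis
    proof (rule that[OF k(1-5) _ _ k(8)])
      show "a0 \<in> A" "b0 \<in> B" using k(6,7) by (simp_all only: nA(2) nB(2))
      show "\<forall>a\<in>A. \<forall>b\<in>B. dist a0 b0 \<le> dist a b \<and> (dist a b = dist a0 b0 \<longrightarrow> a = a0 \<and> b = b0)"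
        by (intro ballI k(9)) (simp_all only: nA(2) nB(2))
    qed
  qed
qed

lemma short_cut_exists:
  assumes "A \<in> walls" "B \<in> walls" "A \<noteq> B"
  obtains g where "short_cut_between A B g"
proof -
  obtain a0 b0 where ab: "a0 \<in> A" "b0 \<in> B" "\<forall>a\<in>A. \<forall>b\<in>B. dist a0 b0 \<le> dist a b"
    by (rule wall_perpendicular[OF assms]) blast
  obtain g where "geodesic_path g" "pathstart g = a0" "pathfinish g = b0" by (rule geodesic_path_exists)
  then have "short_cut_between A B g" using ab by (simp add: short_cut_between_def)
  then show thesis by (rule that)
qed

text \<open>By uniqueness of the closest points, every short cut ends at the feet of the common
  perpendicular. Each foot involves both normals with positive coefficients, so positivity is strict
  even at the ends of the arc.\<close>

lemma short_cut_shape: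
  assumes AB: "A \<in> walls" "B \<in> walls" "A \<noteq> B" and g: "short_cut_between A B g"
  shows "mink (normal A) (normal B) = - cosh (dist (pathstart g) (pathfinish g))"
    and "dist (pathstart g) (pathfinish g) > 0"
    and "\<And>x. x \<in> path_image g \<Longrightarrow> \<exists>a b. a > 0 \<and> b > 0 \<and> coords x = a *\<^sub>R normal A + b *\<^sub>R normal B"
    and "\<And>W. subspace W \<Longrightarrow> coords (pathstart g) \<in> W \<Longrightarrow> coords (pathfinish g) \<in> W \<Longrightarrow>
      normal A \<in> W \<and> normal B \<in> W"
    and "\<And>h. short_cut_between A B h \<Longrightarrow> path_image h = path_image g"
proof -
  obtain k r a0 b0 where k: "k > 1" "r > 0" "mink (normal A) (normal B) = - k"
    "coords a0 = r *\<^sub>R (normal B + k *\<^sub>R normal A)" "coords b0 = r *\<^sub>R (normal A + k *\<^sub>R normal B)"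
    "a0 \<in> A" "b0 \<in> B" "cosh (dist a0 b0) = k"
    "\<forall>a\<in>A. \<forall>b\<in>B. dist a0 b0 \<le> dist a b \<and> (dist a b = dist a0 b0 \<longrightarrow> a = a0 \<and> b = b0)"
    by (rule wall_perpendicular[OF AB])
  have ends: "pathstart h = a0 \<and> pathfinish h = b0 \<and> geodesic_path h" if "short_cut_between A B h" for h
  proof -
    have h: "geodesic_path h" "pathstart h \<in> A" "pathfinish h \<in> B" "dist (pathstart h) (pathfinish h) \<le> dist a0 b0"
      using that k(6,7) by (auto simp: short_cut_between_def)
    then show ?thesis using bspec[OF bspec[OF k(9) h(2)] h(3)] by auto
  qed
  note ge = ends[OF g]
  show "mink (normal A) (normal B) = - cosh (dist (pathstart g) (pathfinish g))" using k ge by simp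
  have "a0 \<noteq> b0" using k(1,8) by auto
  then show "dist (pathstart g) (pathfinish g) > 0" using ge by simp
  show "path_image h = path_image g" if "short_cut_between A B h" for h
    using ends[OF that] ge by (intro path_image_geodesic_unique) auto
  show "\<exists>a b. a > 0 \<and> b > 0 \<and> coords x = a *\<^sub>R normal A + b *\<^sub>R normal B" if x: "x \<in> path_image g" for x
  proof -
    obtain s t where st: "s \<ge> 0" "t \<ge> 0" "coords x = s *\<^sub>R coords a0 + t *\<^sub>R coords b0"
      using geodesic_path_conic[of g x] x ge by metis
    have "s > 0 \<or> t > 0"
    proof (rule ccontr)
      assume "\<not> (s > 0 \<or> t > 0)"
      then have "coords x = 0" using st by (simp add: not_less)
      then show False using mink_coords_self[of x] by (simp add: mink_zero)
    qed
    moreover have "s * k \<ge> s" "t * k \<ge> t"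
      using st(1,2) k(1) mult_left_mono[of 1 k s] mult_left_mono[of 1 k t] by simp_all
    ultimately have "s * k + t > 0" "s + t * k > 0" using st(1,2) by linarith+
    then have "r * (s * k + t) > 0" "r * (s + t * k) > 0" using k(2) by simp_all
    moreover have "coords x = (r * (s * k + t)) *\<^sub>R normal A + (r * (s + t * k)) *\<^sub>R normal B"
      unfolding st(3) k(4,5) by (simp add: algebra_simps)
    ultimately show ?thesis by blast
  qed
  fix W assume W: "subspace W" "coords (pathstart g) \<in> W" "coords (pathfinish g) \<in> W"
  then have ab: "coords a0 \<in> W" "coords b0 \<in> W" using ge by auto
  \<comment> \<open>The factor that appears when the equations for the two feet are solved for the
    normals.\<close>
  have nz: "r * (k * k - 1) \<noteq> 0" using k(1,2) by (simp add: less_1_mult less_imp_neq[symmetric])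
  have "k *\<^sub>R coords a0 - coords b0 = (r * (k * k - 1)) *\<^sub>R normal A"
    "k *\<^sub>R coords b0 - coords a0 = (r * (k * k - 1)) *\<^sub>R normal B"
    unfolding k(4,5) by (simp_all add: algebra_simps)
  moreover have "k *\<^sub>R coords a0 - coords b0 \<in> W" "k *\<^sub>R coords b0 - coords a0 \<in> W"
    using W(1) ab by (auto intro!: subspace_diff subspace_scale)
  ultimately have "(1 / (r * (k * k - 1))) *\<^sub>R ((r * (k * k - 1)) *\<^sub>R normal A) \<in> W"
    "(1 / (r * (k * k - 1))) *\<^sub>R ((r * (k * k - 1)) *\<^sub>R normal B) \<in> W"
    using W(1) by (auto intro!: subspace_scale simp del: scaleR_scaleR)
  then show "normal A \<in> W \<and> normal B \<in> W" using nz by simp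
qed

lemma short_cut_in_X:
  assumes "A \<in> walls" "B \<in> walls" "short_cut_between A B g"
  shows "geodesic_path g" "path_image g \<subseteq> X"
proof -
  have g: "geodesic_path g" "pathstart g \<in> A" "pathfinish g \<in> B"
    using assms(3) by (auto simp: short_cut_between_def)
  show "geodesic_path g" by (rule g(1))
  show "path_image g \<subseteq> X"
    using segment_in_X[OF g(1)] g(2,3) walls_subset(2)[OF assms(1)] walls_subset(2)[OF assms(2)] by blast
qed

section \<open>Lifts of the shortest return path\<close>

text \<open>Over short parameter intervals \<open>g\<close> and \<open>l\<close> have the same
  distances as their common projection, so \<open>l\<close> is a local geodesic with the speed of
  \<open>g\<close>.\<close>

lemma lift_geodesic:
  assumes g: "geodesic_path g" "path_image g \<subseteq> X"
    and l: "path l" "path_image l \<subseteq> X" "\<And>t. t \<in> {0..1} \<Longrightarrow> p (l t) = p (g t)"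
  shows "geodesic_path l" "dist (pathstart l) (pathfinish l) = dist (pathstart g) (pathfinish g)"
proof -
  obtain \<delta>1 where d1: "\<delta>1 > 0"
    "\<And>s t. \<lbrakk>s \<in> {0..1}; t \<in> {0..1}; \<bar>s - t\<bar> < \<delta>1\<rbrakk> \<Longrightarrow>
      dist (p (g s)) (p (g t)) = \<bar>s - t\<bar> * dist (pathstart g) (pathfinish g)"
    using geodesic_projection[OF g] by blast
  obtain \<delta>2 where d2: "\<delta>2 > 0"
    "\<And>s t. \<lbrakk>s \<in> {0..1}; t \<in> {0..1}; \<bar>s - t\<bar> < \<delta>2\<rbrakk> \<Longrightarrow> dist (p (l s)) (p (l t)) = dist (l s) (l t)"
    using path_local_isometry[OF l(1,2)] by blast
  have "min \<delta>1 \<delta>2 > 0" using d1 d2 by simp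
  moreover have "dist (l s) (l t) = \<bar>s - t\<bar> * dist (pathstart g) (pathfinish g)"
    if st: "s \<in> {0..1}" "t \<in> {0..1}" "\<bar>s - t\<bar> < min \<delta>1 \<delta>2" for s t
    using d1(2)[OF st(1,2)] d2(2)[OF st(1,2)] st(3) l(3)[OF st(1)] l(3)[OF st(2)] by simp
  ultimately show "geodesic_path l" "dist (pathstart l) (pathfinish l) = dist (pathstart g) (pathfinish g)"
    using local_geodesic_imp_geodesic[of "min \<delta>1 \<delta>2" "dist (pathstart g) (pathfinish g)" l] by auto
qed

lemma path_in_frontier_iff:
  assumes "path_image l \<subseteq> X" "path_image g \<subseteq> X" "\<And>t. t \<in> {0..1} \<Longrightarrow> p (l t) = p (g t)" "t \<in> {0..1}"
  shows "l t \<in> frontier X \<longleftrightarrow> g t \<in> frontier X"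
proof -
  have "l t \<in> X" "g t \<in> X" using assms by (auto simp: path_image_def)
  then show ?thesis using assms(3)[OF assms(4)] frontier_image boundary_preimage by metis
qed

text \<open>If both ends of the lift lay in one wall, the whole lift would; then its projection
  would stay in the boundary, and \<open>g\<close> would be a connected subset of the frontier
  joining \<open>A\<close> to \<open>B\<close>.\<close>

lemma lift_short_cut:
  assumes AB: "A \<in> walls" "B \<in> walls" "A \<noteq> B" and g: "short_cut_between A B g"
    and l: "path l" "path_image l \<subseteq> X" "\<And>t. t \<in> {0..1} \<Longrightarrow> p (l t) = p (g t)"
  obtains A' B' where "A' \<in> walls" "B' \<in> walls" "A' \<noteq> B'" "pathstart l \<in> A'" "pathfinish l \<in> B'"
    "geodesic_path l" "dist (pathstart l) (pathfinish l) = dist (pathstart g) (pathfinish g)"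
proof -
  note gX = short_cut_in_X[OF AB(1,2) g]
  note lg = lift_geodesic[OF gX l]
  note fr = path_in_frontier_iff[OF l(2) gX(2) l(3)]
  have gAB: "g 0 \<in> A" "g 1 \<in> B" using g by (auto simp: short_cut_between_def pathstart_def pathfinish_def)
  have "g 0 \<in> frontier X" "g 1 \<in> frontier X" using gAB walls_subset(1) AB by blast+
  then have "l 0 \<in> frontier X" "l 1 \<in> frontier X" using fr[of 0] fr[of 1] by simp_all
  then obtain A' B' where AB': "A' \<in> walls" "l 0 \<in> A'" "B' \<in> walls" "l 1 \<in> B'"
    using wall_through by metis
  have "A' \<noteq> B'"
  proof
    assume "A' = B'"
    have "l t \<in> A'" if "t \<in> {0..1}" for t
    proof -
      have "l t \<in> path_image l" using that by (auto simp: path_image_def)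
      then obtain u v where "coords (l t) = u *\<^sub>R coords (l 0) + v *\<^sub>R coords (l 1)"
        using geodesic_path_conic[OF lg(1)] unfolding pathstart_def pathfinish_def by metis
      then show ?thesis
        using normal(2)[OF AB'(1)] AB' \<open>A' = B'\<close> by (simp add: mink_bilinear)
    qed
    then have "l t \<in> frontier X" if "t \<in> {0..1}" for t using that walls_subset(1)[OF AB'(1)] by blast
    then have "path_image g \<subseteq> frontier X" using fr by (auto simp: path_image_def)
    moreover have "connected (path_image g)"
      by (rule connected_path_image[OF geodesic_path_imp_path[OF gX(1)]])
    moreover have "g 0 \<in> path_image g" "g 1 \<in> path_image g" by (auto simp: path_image_def)
    ultimately have "A = B"
      using walls_eq[of "path_image g" A B] AB(1,2) gAB by blast
    then show False using AB(3) by simp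
  qed
  then show thesis using that[of A' B'] AB' lg by (simp add: pathstart_def pathfinish_def)
qed

text \<open>Every short cut projects to some \<open>lam i\<close> up to reversal, and
  \<open>curve_length\<close> in \<open>N\<close> agrees with the length in \<open>X\<close>; so the
  ordering of the enumeration bounds the length of every short cut below by
  \<open>D\<close>.\<close>

lemma shortest_return_path:
  assumes enum: "return_path_enumeration X p lam"
  obtains D where "D > 0"
    "\<forall>A\<in>walls. \<forall>B\<in>walls. A \<noteq> B \<longrightarrow> mink (normal A) (normal B) \<le> - cosh D"
    "\<forall>L\<in>lifts X p (lam 1). \<exists>A B l. A \<in> walls \<and> B \<in> walls \<and> A \<noteq> B \<and>
      short_cut_between A B l \<and> L = path_image l \<and> dist (pathstart l) (pathfinish l) = D"
proof -
  have "return_path X p (lam 1)" using enum unfolding return_path_enumeration_def by blast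
  then obtain A1 B1 g1 where 1: "A1 \<in> walls" "B1 \<in> walls" "A1 \<noteq> B1" "short_cut_between A1 B1 g1" "lam 1 = p \<circ> g1"
    by (auto simp: return_path_def short_cut_def)
  define D where "D = dist (pathstart g1) (pathfinish g1)"
  have D: "D > 0" using short_cut_shape(2)[OF 1(1-4)] by (simp add: D_def)
  have len1: "curve_length (lam 1) = ereal D"
    unfolding D_def by (rule curve_length_projection[OF short_cut_in_X[OF 1(1,2,4)]]) (simp add: 1(5) del: One_nat_def)
  have min: "D \<le> dist (pathstart g) (pathfinish g)"
    if AB: "A \<in> walls" "B \<in> walls" "A \<noteq> B" and g: "short_cut_between A B g" for A B g
  proof -
    have "return_path X p (p \<circ> g)" using AB g by (auto simp: return_path_def short_cut_def)
    then obtain i where i: "i \<ge> 1" "same_unoriented_path (p \<circ> g) (lam i)"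
      using enum unfolding return_path_enumeration_def by blast
    have le: "curve_length (lam 1) \<le> curve_length (lam i)"
      using enum i(1) unfolding return_path_enumeration_def by blast
    have "curve_length (lam i) = ereal (dist (pathstart g) (pathfinish g))"
      using i(2) unfolding same_unoriented_path_def
    proof
      assume *: "\<forall>t\<in>{0..1}. (p \<circ> g) t = lam i t"
      then show ?thesis
        by (intro curve_length_projection[OF short_cut_in_X[OF AB(1,2) g]]) auto
    next
      assume *: "\<forall>t\<in>{0..1}. (p \<circ> g) t = reversepath (lam i) t"
      have "lam i t = p (reversepath g t)" if "t \<in> {0..1}" for t
        using bspec[OF *, of "1 - t"] that by (simp add: reversepath_def)
      then have "curve_length (lam i) = ereal (dist (pathstart (reversepath g)) (pathfinish (reversepath g)))"
        by (rule curve_length_projection[OF short_cut_in_X[OF AB(2,1) short_cut_between_reverse[OF g]]])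
      then show ?thesis by (simp add: dist_commute)
    qed
    then show ?thesis using le len1 by simp
  qed
  have cosh: "mink (normal A) (normal B) \<le> - cosh D" if AB: "A \<in> walls" "B \<in> walls" "A \<noteq> B" for A B
  proof -
    obtain g where g: "short_cut_between A B g" by (rule short_cut_exists[OF AB])
    have "cosh D \<le> cosh (dist (pathstart g) (pathfinish g))"
      using min[OF AB g] D by (simp add: cosh_real_nonneg_le_iff)
    then show ?thesis using short_cut_shape(1)[OF AB g] by simp
  qed
  have lift: "\<exists>A B l. A \<in> walls \<and> B \<in> walls \<and> A \<noteq> B \<and>
      short_cut_between A B l \<and> L = path_image l \<and> dist (pathstart l) (pathfinish l) = D"
    if L: "L \<in> lifts X p (lam 1)" for L
  proof -
    obtain l where l: "L = path_image l" "path l" "path_image l \<subseteq> X" "\<forall>t\<in>{0..1}. p (l t) = lam 1 t"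
      using L unfolding lifts_def by blast
    have pl: "p (l t) = p (g1 t)" if "t \<in> {0..1}" for t
      using bspec[OF l(4) that] unfolding 1(5) by simp
    obtain A B where AB: "A \<in> walls" "B \<in> walls" "A \<noteq> B" "pathstart l \<in> A" "pathfinish l \<in> B"
      "geodesic_path l" "dist (pathstart l) (pathfinish l) = D"
      unfolding D_def by (rule lift_short_cut[OF 1(1-4) l(2,3) pl])
    obtain g where g: "short_cut_between A B g" by (rule short_cut_exists[OF AB(1-3)])
    \<comment> \<open>No deck transformation is involved: the lift has length \<open>D\<close>, and
      no short cut between its two walls is shorter.\<close>
    have "D \<le> dist a b" if "a \<in> A" "b \<in> B" for a b
      using min[OF AB(1-3) g] g that by (fastforce simp: short_cut_between_def)
    then have "short_cut_between A B l" using AB by (simp add: short_cut_between_def)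
    then show ?thesis using AB(1-3,7) l(1) by (intro exI conjI)
  qed
  show thesis
  proof (rule that[OF D])
    show "\<forall>A\<in>walls. \<forall>B\<in>walls. A \<noteq> B \<longrightarrow> mink (normal A) (normal B) \<le> - cosh D"
      by (intro ballI impI cosh)
  qed (intro ballI lift)
qed

section \<open>The hexagon inside the cone of its normals\<close>

text \<open>The three normals form a basis of the subspace carrying the plane, so their coefficients
  are coordinates on it. Internal edges lie in the cone by \<open>short_cut_shape\<close>, external
  ones because their ends do, and the enclosed region by
  \<open>conic_comb_bounded_component\<close>.\<close>

lemma hexagon_conic:
  assumes hex: "hexagon X C e12 e23 e31" and "D > 0"
    and far: "\<forall>A\<in>walls. \<forall>B\<in>walls. A \<noteq> B \<longrightarrow> mink (normal A) (normal B) \<le> - cosh D"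
    and len: "\<forall>e\<in>{e12, e23, e31}. \<exists>l. geodesic_path l \<and> e = path_image l \<and>
      dist (pathstart l) (pathfinish l) = D"
  obtains I where "I \<subseteq> walls" "card I = 3"
    "\<forall>A\<in>I. \<forall>B\<in>I. mink (normal A) (normal B) = (if A = B then 1 else - cosh D)"
    "\<forall>A\<in>I. \<forall>B\<in>I. A \<noteq> B \<longrightarrow> (\<exists>g. short_cut_between A B g \<and> path_image g \<in> {e12, e23, e31})"
    "\<forall>x\<in>C. conic_comb I normal x"
proof -
  obtain A1 A2 A3 g12 g23 g31 h1 h2 h3 P E where
    walls: "{A1, A2, A3} \<subseteq> walls" and ne: "A1 \<noteq> A2" "A2 \<noteq> A3" "A3 \<noteq> A1" and
    g12: "short_cut_between A1 A2 g12" "e12 = path_image g12" and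
    g23: "short_cut_between A2 A3 g23" "e23 = path_image g23" and
    g31: "short_cut_between A3 A1 g31" "e31 = path_image g31" and
    h1: "geodesic_path h1" "pathstart h1 = pathfinish g31" "pathfinish h1 = pathstart g12" and
    h2: "geodesic_path h2" "pathstart h2 = pathfinish g12" "pathfinish h2 = pathstart g23" and
    h3: "geodesic_path h3" "pathstart h3 = pathfinish g23" "pathfinish h3 = pathstart g31" and
    E: "E = e12 \<union> e23 \<union> e31 \<union> path_image h1 \<union> path_image h2 \<union> path_image h3" and
    P: "hyp_plane P" "E \<subseteq> P" and
    C: "C = E \<union> {x \<in> P - E. bounded (connected_component_set (P - E) x)}"
    using hex unfolding hexagon_def by (elim exE conjE) (rule that; assumption)
  define I where "I = {A1, A2, A3}"
  have I: "finite I" "card I = 3" "I \<subseteq> walls" using walls ne by (auto simp: I_def)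
  have c1: "cosh D > 1" using cosh_real_nonneg_less_iff[of 0 D] \<open>D > 0\<close> by simp
  define edges where "edges = {e12, e23, e31}"
  have edge: "\<exists>g. short_cut_between A B g \<and> path_image g \<in> edges" if "A \<in> I" "B \<in> I" "A \<noteq> B" for A B
    using that g12 g23 g31 short_cut_between_reverse[OF g12(1)] short_cut_between_reverse[OF g23(1)]
      short_cut_between_reverse[OF g31(1)] unfolding I_def edges_def
    by (smt (verit) empty_iff insert_iff path_image_reversepath)
  have mm: "mink (normal A) (normal B) = (if A = B then 1 else - cosh D)" if AB: "A \<in> I" "B \<in> I" for A B
  proof (cases "A = B")
    case False
    obtain g where g: "short_cut_between A B g" "path_image g \<in> edges" using edge[OF AB False] by blast
    have ABw: "A \<in> walls" "B \<in> walls" using AB I by auto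
    obtain l where l: "geodesic_path l" "path_image g = path_image l" "dist (pathstart l) (pathfinish l) = D"
      using bspec[OF len g(2)[unfolded edges_def]] by blast
    \<comment> \<open>The short cut \<open>g\<close> and the lift \<open>l\<close> are known to
      share only their image. The ends of \<open>g\<close> are points of \<open>l\<close>, so its
      length is at most \<open>D\<close>; \<open>far\<close> gives the other inequality.\<close>
    have "pathstart g \<in> l ` {0..1}" "pathfinish g \<in> l ` {0..1}"
      using l(2) pathstart_in_path_image[of g] pathfinish_in_path_image[of g] by (simp_all add: path_image_def)
    then obtain s t where st: "s \<in> {0..1}" "t \<in> {0..1}" "pathstart g = l s" "pathfinish g = l t" by blast
    have "dist (pathstart g) (pathfinish g) = \<bar>s - t\<bar> * D"
      using geodesic_path_dist[OF l(1) st(1,2)] st(3,4) l(3) by simp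
    also have "\<dots> \<le> 1 * D" using st \<open>D > 0\<close> by (intro mult_right_mono) auto
    finally have "cosh (dist (pathstart g) (pathfinish g)) \<le> cosh D"
      using \<open>D > 0\<close> by (simp add: cosh_real_nonneg_le_iff)
    then show ?thesis
      using short_cut_shape(1)[OF ABw False g(1)] far ABw False by force
  qed (use normal(1) I AB in auto)
  have conic_edge: "conic_comb I normal x"
    if x: "x \<in> path_image g" and AB: "A \<in> I" "B \<in> I" "A \<noteq> B" and g: "short_cut_between A B g" for x g A B
  proof -
    obtain a b where "a > 0" "b > 0" "coords x = a *\<^sub>R normal A + b *\<^sub>R normal B"
      using short_cut_shape(3)[OF _ _ AB(3) g x] AB(1,2) I(3) by blast
    then show ?thesis using conic_comb_pair[OF I(1) AB, of a b x normal] by simp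
  qed
  have AI: "A1 \<in> I" "A2 \<in> I" "A3 \<in> I" by (simp_all add: I_def)
  note c12 = conic_edge[OF _ AI(1,2) ne(1) g12(1)]
    and c23 = conic_edge[OF _ AI(2,3) ne(2) g23(1)]
    and c31 = conic_edge[OF _ AI(3,1) ne(3) g31(1)]
  have conE: "conic_comb I normal x" if xE: "x \<in> E" for x
  proof -
    consider "x \<in> e12" | "x \<in> e23" | "x \<in> e31" | "x \<in> path_image h1" | "x \<in> path_image h2" | "x \<in> path_image h3"
      using xE E by blast
    then show ?thesis
    proof cases
      case 4
      show ?thesis by (rule conic_comb_geodesic[OF h1(1) _ _ 4]) (simp_all add: h1 c12 c31 pathstart_in_path_image pathfinish_in_path_image)
    next
      case 5
      show ?thesis by (rule conic_comb_geodesic[OF h2(1) _ _ 5]) (simp_all add: h2 c12 c23 pathstart_in_path_image pathfinish_in_path_image)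
    next
      case 6
      show ?thesis by (rule conic_comb_geodesic[OF h3(1) _ _ 6]) (simp_all add: h3 c31 c23 pathstart_in_path_image pathfinish_in_path_image)
    qed (use c12 c23 c31 g12 g23 g31 in auto)
  qed
  obtain W where W: "subspace W" "dim W = 3" "P = {x. coords x \<in> W}" using P(1) by (auto simp: hyp_plane_def)
  have EW: "coords x \<in> W" if "x \<in> E" for x using that P(2) W(3) by auto
  have pW: "coords (pathstart g) \<in> W" "coords (pathfinish g) \<in> W" if "path_image g \<in> edges" for g
    using that E by (auto intro!: EW simp: edges_def)
  \<comment> \<open>Two edges suffice: both lie in \<open>P\<close>, and the ends of each determine
    the normals of the walls that it joins.\<close>
  have nW: "normal A \<in> W" if "A \<in> I" for A
    using short_cut_shape(4)[OF _ _ ne(1) g12(1) W(1)] short_cut_shape(4)[OF _ _ ne(2) g23(1) W(1)]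
      pW[of g12] pW[of g23] g12(2) g23(2) walls that by (auto simp: I_def edges_def)
  have ind: "u i = 0" if "(\<Sum>i\<in>I. u i *\<^sub>R normal i) = 0" "i \<in> I" for u i
    by (rule equidistant_normals_independent[OF I(1) _ _ mm that]) (use c1 I(2) in auto)
  have inj: "inj_on normal I"
  proof (rule inj_onI)
    fix A B assume AB: "A \<in> I" "B \<in> I" "normal A = normal B"
    show "A = B" using mm[OF AB(1,1)] mm[OF AB(1,2)] AB(3) c1 by (auto split: if_splits)
  qed
  have conC: "conic_comb I normal x" if "x \<in> C" for x
  proof (cases "x \<in> E")
    case False
    then have x: "x \<in> P - E" "bounded (connected_component_set (P - E) x)" using that C by auto
    show ?thesis
    proof (rule conic_comb_bounded_component[OF W(1,3) I(1) _ _ _ _ _ _ x])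
      show "\<exists>a. v = (\<Sum>i\<in>I. a i *\<^sub>R normal i)" if "v \<in> W" for v
      proof (rule span_family[OF I(1) inj _ _ _ that])
        show "u i = 0" if "(\<Sum>i\<in>I. u i *\<^sub>R normal i) = 0" "i \<in> I" for u i
          by (rule ind[OF that])
      qed (use nW W(2) I(2) in auto)
      show "u i = 0" if "(\<Sum>i\<in>I. u i *\<^sub>R normal i) = 0" "i \<in> I" for u i
        by (rule ind[OF that])
    qed (use I(2) mm nW conE in auto)
  qed (rule conE)
  show thesis
  proof (rule that[OF I(3,2)])
    show "\<forall>A\<in>I. \<forall>B\<in>I. mink (normal A) (normal B) = (if A = B then 1 else - cosh D)"
      by (intro ballI mm)
    show "\<forall>A\<in>I. \<forall>B\<in>I. A \<noteq> B \<longrightarrow> (\<exists>g. short_cut_between A B g \<and> path_image g \<in> {e12, e23, e31})"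
      using edge unfolding edges_def by blast
    show "\<forall>x\<in>C. conic_comb I normal x" by (intro ballI conC)
  qed
qed

end

theorem lemma5p1:
  fixes N :: "'n::metric_space set"
    and X :: "hyp3 set"
    and p :: "hyp3 \<Rightarrow> 'n"
    and lam :: "nat \<Rightarrow> real \<Rightarrow> 'n"
    and C e1 e2 e3 L :: "hyp3 set"
  assumes "hyperbolic_3_manifold N"
    and "finite_volume N"
    and "compact (mfd_boundary N)"
    and "hyp_universal_cover X p N"
    and "return_path_enumeration X p lam"
    and "ijk_hexagon X p lam 1 1 1 C e1 e2 e3"
    and "L \<in> lifts X p (lam 1)"
  shows "L \<in> {e1, e2, e3} \<or> L \<inter> C = {}"
proof (rule ccontr)
  interpret hyp_cover X p N using assms by unfold_locales
  assume "\<not> ?thesis"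
  then obtain x where x: "x \<in> L" "x \<in> C" and L: "L \<notin> {e1, e2, e3}" by blast
  obtain D where D: "D > 0"
    and far: "\<forall>A\<in>walls. \<forall>B\<in>walls. A \<noteq> B \<longrightarrow> mink (normal A) (normal B) \<le> - cosh D"
    and short: "\<forall>L\<in>lifts X p (lam 1). \<exists>A B l. A \<in> walls \<and> B \<in> walls \<and> A \<noteq> B \<and>
      short_cut_between A B l \<and> L = path_image l \<and> dist (pathstart l) (pathfinish l) = D"
    by (rule shortest_return_path[OF assms(5)])
  have hex: "hexagon X C e1 e2 e3" and e: "{e1, e2, e3} \<subseteq> lifts X p (lam 1)"
    using assms(6) by (auto simp: ijk_hexagon_def)
  have len: "\<forall>e\<in>{e1, e2, e3}. \<exists>l. geodesic_path l \<and> e = path_image l \<and> dist (pathstart l) (pathfinish l) = D"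
  proof
    fix e' assume "e' \<in> {e1, e2, e3}"
    then have "e' \<in> lifts X p (lam 1)" using e by blast
    then show "\<exists>l. geodesic_path l \<and> e' = path_image l \<and> dist (pathstart l) (pathfinish l) = D"
      using bspec[OF short] unfolding short_cut_between_def by blast
  qed
  obtain I where I: "I \<subseteq> walls" "card I = 3"
    "\<forall>A\<in>I. \<forall>B\<in>I. mink (normal A) (normal B) = (if A = B then 1 else - cosh D)"
    "\<forall>A\<in>I. \<forall>B\<in>I. A \<noteq> B \<longrightarrow> (\<exists>g. short_cut_between A B g \<and> path_image g \<in> {e1, e2, e3})"
    "\<forall>x\<in>C. conic_comb I normal x"
    by (rule hexagon_conic[OF hex D far len])
  obtain A B l where l: "A \<in> walls" "B \<in> walls" "A \<noteq> B" "short_cut_between A B l" "L = path_image l"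
    "dist (pathstart l) (pathfinish l) = D"
    using bspec[OF short assms(7)] by blast
  obtain a where a: "\<And>i. i \<in> I \<Longrightarrow> a i \<ge> 0" "coords x = (\<Sum>i\<in>I. a i *\<^sub>R normal i)"
    using bspec[OF I(5) x(2)] by (auto simp: conic_comb_def)
  obtain s t where st: "s > 0" "t > 0" "coords x = s *\<^sub>R normal A + t *\<^sub>R normal B"
    using short_cut_shape(3)[OF l(1-4)] x(1) l(5) by blast
  define b where "b i = (if i = A then s else t)" for i
  have sb: "coords x = (\<Sum>i\<in>{A, B}. b i *\<^sub>R normal i)" using l(3) by (simp add: b_def st)
  have AB: "mink (normal A) (normal B) = - cosh D" using short_cut_shape(1)[OF l(1-4)] l(6) by simp
  \<comment> \<open>The point \<open>x\<close> has two expansions, over three walls with nonnegative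
    and over two with positive coefficients.\<close>
  have "{A, B} \<subseteq> I"
  proof (rule equidistant_normals_subset[where c = "cosh D" and a = a and b = b and \<nu> = normal])
    show "finite I" using I(2) card_ge_0_finite[of I] by simp
    show "card {A, B} < card I" using l(3) I(2) by simp
    show "(\<Sum>i\<in>I. a i *\<^sub>R normal i) = (\<Sum>i\<in>{A, B}. b i *\<^sub>R normal i)" using a(2) sb by simp
    show "mink (normal i) (normal j) = (if i = j then 1 else - cosh D)" if "i \<in> {A, B}" "j \<in> {A, B}" for i j
      using that AB l(1-3) normal(1) mink_commute[of "normal B" "normal A"] by auto
    show "mink (normal i) (normal j) \<le> - cosh D" if "i \<in> I" "j \<in> {A, B}" "i \<noteq> j" for i j
      using that I(1) l(1,2) far by blast
  qed (use a(1) st I(3) in \<open>auto simp: b_def\<close>)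
  \<comment> \<open>Both walls of the arc belong to the hexagon, so one of its internal edges is a
    short cut between them, and it has the same image as the arc.\<close>
  then have "A \<in> I" "B \<in> I" by simp_all
  then have "\<exists>g. short_cut_between A B g \<and> path_image g \<in> {e1, e2, e3}"
    by (rule mp[OF bspec[OF bspec[OF I(4)]] l(3)])
  then obtain g where g: "short_cut_between A B g" "path_image g \<in> {e1, e2, e3}"
    by (elim exE conjE)
  then show False using L short_cut_shape(5)[OF l(1-4) g(1)] l(5) by simp
qed

end
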